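(* Let $A$ be a $C^*$-algebra and $M$ a $C^*$-subalgebra of $A$. Suppose that $S$ is a collection of states of $M$ such that (a) every $\phi\in S$ has a unique extension to a state $\tilde\phi$ of $A$; and (b) the direct sum $\bigoplus_{\phi \in S} \pi_{\tilde\phi}$ of the GNS representations of $A$ associated to the extensions $\tilde\phi$ of elements $\phi$ of $S$ is faithful on $A$. Let $B$ be a $C^*$-algebra and let $\rho : A \to B$ be a $C^*$-homomorphism. Then $\rho$ is injective if and only if it is injective on $M$.
   Context: A $C^*$-homomorphism is a $*$-homomorphism between $C^*$-algebras. Neither $A$ nor $M$ is assumed unital, and $M$ is not assumed abelian. For a state $\psi$ of $A$, $\pi_\psi$ denotes its GNS representation. *)

theory Defs
  imports "HOL-Analysis.Analysis"
begin

class complex_vector = real_vector +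
  fixes scaleC :: "complex \<Rightarrow> 'a \<Rightarrow> 'a"  (infixr "*\<^sub>C" 75)
  assumes scaleC_add_right: "c *\<^sub>C (x + y) = c *\<^sub>C x + c *\<^sub>C y"
    and scaleC_add_left: "(c + d) *\<^sub>C x = c *\<^sub>C x + d *\<^sub>C x"
    and scaleC_scaleC: "c *\<^sub>C d *\<^sub>C x = (c * d) *\<^sub>C x"
    and scaleR_scaleC: "r *\<^sub>R x = complex_of_real r *\<^sub>C x"

text \<open>C*-algebras are not assumed unital, and the zero algebra is allowed.\<close>

class cstar_algebra = complex_vector + real_normed_algebra + banach +
  fixes star :: "'a \<Rightarrow> 'a"
  assumes norm_scaleC: "norm (c *\<^sub>C x) = cmod c * norm x"
    and mult_scaleC_left: "(c *\<^sub>C x) * y = c *\<^sub>C (x * y)"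
    and mult_scaleC_right: "x * (c *\<^sub>C y) = c *\<^sub>C (x * y)"
    and star_add: "star (x + y) = star x + star y"
    and star_scaleC: "star (c *\<^sub>C x) = cnj c *\<^sub>C star x"
    and star_mult: "star (x * y) = star y * star x"
    and star_star: "star (star x) = x"
    and cstar_identity: "norm (star x * x) = (norm x)\<^sup>2"

instantiation complex :: cstar_algebra
begin

definition scaleC_complex :: "complex \<Rightarrow> complex \<Rightarrow> complex" where
  "scaleC_complex c x = c * x"

definition star_complex :: "complex \<Rightarrow> complex" where
  "star_complex x = cnj x"

instance
  by standard
    (auto simp: scaleC_complex_def star_complex_def algebra_simps scaleR_conv_of_real
      norm_mult power2_eq_square)

end

definition cstar_subalgebra :: "'a::cstar_algebra set \<Rightarrow> bool" where
  "cstar_subalgebra M \<longleftrightarrow>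
     0 \<in> M \<and> (\<forall>x\<in>M. \<forall>y\<in>M. x + y \<in> M) \<and> (\<forall>c. \<forall>x\<in>M. c *\<^sub>C x \<in> M) \<and>
     (\<forall>x\<in>M. \<forall>y\<in>M. x * y \<in> M) \<and> (\<forall>x\<in>M. star x \<in> M) \<and> closed M"

definition cstar_hom :: "('a::cstar_algebra \<Rightarrow> 'b::cstar_algebra) \<Rightarrow> bool" where
  "cstar_hom \<rho> \<longleftrightarrow>
     (\<forall>x y. \<rho> (x + y) = \<rho> x + \<rho> y) \<and> (\<forall>c x. \<rho> (c *\<^sub>C x) = c *\<^sub>C \<rho> x) \<and>
     (\<forall>x y. \<rho> (x * y) = \<rho> x * \<rho> y) \<and> (\<forall>x. \<rho> (star x) = star (\<rho> x))"

text \<open>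
  The states of a C*-subalgebra \<open>M\<close> are its positive linear functionals of norm 1. They are
  extensional functions (\<open>undefined\<close> off \<open>M\<close>), so that equality of states of \<open>M\<close> is equality
  on \<open>M\<close>. The states of the whole algebra are \<open>states UNIV\<close>. Boundedness is stated separately
  because the supremum of an unbounded set of reals is a junk value.
\<close>

definition states :: "'a::cstar_algebra set \<Rightarrow> ('a \<Rightarrow> complex) set" where
  "states M = {\<phi> \<in> extensional M.
     (\<forall>x\<in>M. \<forall>y\<in>M. \<phi> (x + y) = \<phi> x + \<phi> y) \<and>
     (\<forall>c. \<forall>x\<in>M. \<phi> (c *\<^sub>C x) = c * \<phi> x) \<and>
     (\<forall>x\<in>M. \<phi> (star x * x) \<in> \<real>\<^sub>\<ge>\<^sub>0) \<and>
     bdd_above ((\<lambda>x. cmod (\<phi> x)) ` {x \<in> M. norm x \<le> 1}) \<and>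
     (SUP x\<in>{x \<in> M. norm x \<le> 1}. cmod (\<phi> x)) = 1}"

definition extends_state :: "'a::cstar_algebra set \<Rightarrow> ('a \<Rightarrow> complex) \<Rightarrow> ('a \<Rightarrow> complex) \<Rightarrow> bool" where
  "extends_state M \<phi> \<psi> \<longleftrightarrow> \<psi> \<in> states UNIV \<and> restrict \<psi> M = \<phi>"

definition the_extension :: "'a::cstar_algebra set \<Rightarrow> ('a \<Rightarrow> complex) \<Rightarrow> ('a \<Rightarrow> complex)" where
  "the_extension M \<phi> = (THE \<psi>. extends_state M \<phi> \<psi>)"

text \<open>
  The Hilbert space of a GNS representation depends on the state, so Hilbert spaces are given
  by explicit carriers. Inner products are linear in the first argument.
\<close>

record 'h hilbert =
  hcarrier :: "'h set"
  hadd :: "'h \<Rightarrow> 'h \<Rightarrow> 'h"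
  hscale :: "complex \<Rightarrow> 'h \<Rightarrow> 'h"
  hinner :: "'h \<Rightarrow> 'h \<Rightarrow> complex"

definition hnorm :: "'h hilbert \<Rightarrow> 'h \<Rightarrow> real" where
  "hnorm H \<xi> = sqrt (Re (hinner H \<xi> \<xi>))"

text \<open>
  Hilbert space completion of a vector space with positive semidefinite sesquilinear form \<open>s\<close>:
  Cauchy sequences modulo sequences tending to 0 in the seminorm of \<open>s\<close>. Dividing by the null
  sequences also divides by the null space \<open>{x. s x x = 0}\<close>, so no separate quotient is needed:
  the classes of the constant sequences form a dense copy of the space modulo its null space.
\<close>

definition form_seminorm :: "('a \<Rightarrow> 'a \<Rightarrow> complex) \<Rightarrow> 'a \<Rightarrow> real" where
  "form_seminorm s x = sqrt (Re (s x x))"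

definition form_Cauchy :: "('a::complex_vector \<Rightarrow> 'a \<Rightarrow> complex) \<Rightarrow> (nat \<Rightarrow> 'a) set" where
  "form_Cauchy s =
     {X. \<forall>e>0. \<exists>N. \<forall>m\<ge>N. \<forall>n\<ge>N. form_seminorm s (X m - X n) < e}"

definition form_rel ::
  "('a::complex_vector \<Rightarrow> 'a \<Rightarrow> complex) \<Rightarrow> ((nat \<Rightarrow> 'a) \<times> (nat \<Rightarrow> 'a)) set" where
  "form_rel s = {(X, Y). X \<in> form_Cauchy s \<and> Y \<in> form_Cauchy s \<and>
     (\<lambda>n. form_seminorm s (X n - Y n)) \<longlonglongrightarrow> 0}"

definition completion :: "('a::complex_vector \<Rightarrow> 'a \<Rightarrow> complex) \<Rightarrow> (nat \<Rightarrow> 'a) set hilbert" where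
  "completion s = \<lparr>
     hcarrier = form_Cauchy s // form_rel s,
     hadd = (\<lambda>\<xi> \<eta>. \<Union>X\<in>\<xi>. \<Union>Y\<in>\<eta>. form_rel s `` {\<lambda>n. X n + Y n}),
     hscale = (\<lambda>c \<xi>. \<Union>X\<in>\<xi>. form_rel s `` {\<lambda>n. c *\<^sub>C X n}),
     hinner = (\<lambda>\<xi> \<eta>. THE c. \<forall>X\<in>\<xi>. \<forall>Y\<in>\<eta>. (\<lambda>n. s (X n) (Y n)) \<longlonglongrightarrow> c) \<rparr>"

definition gns_form :: "('a::cstar_algebra \<Rightarrow> complex) \<Rightarrow> 'a \<Rightarrow> 'a \<Rightarrow> complex" where
  "gns_form \<psi> a b = \<psi> (star b * a)"

definition gns_space :: "('a::cstar_algebra \<Rightarrow> complex) \<Rightarrow> (nat \<Rightarrow> 'a) set hilbert" where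
  "gns_space \<psi> = completion (gns_form \<psi>)"

text \<open>
  \<open>gns_rep \<psi> a\<close> is the continuous extension of left multiplication by \<open>a\<close>. Operators are
  extensional on the carrier of the Hilbert space, so that equality of operators is equality
  of functions.
\<close>

definition gns_rep ::
  "('a::cstar_algebra \<Rightarrow> complex) \<Rightarrow> 'a \<Rightarrow> (nat \<Rightarrow> 'a) set \<Rightarrow> (nat \<Rightarrow> 'a) set" where
  "gns_rep \<psi> a =
     (\<lambda>\<xi>\<in>hcarrier (gns_space \<psi>). \<Union>X\<in>\<xi>. form_rel (gns_form \<psi>) `` {\<lambda>n. a * X n})"

definition direct_sum_space :: "'i set \<Rightarrow> ('i \<Rightarrow> 'h hilbert) \<Rightarrow> ('i \<Rightarrow> 'h) hilbert" where
  "direct_sum_space I H = \<lparr>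
     hcarrier = {f \<in> (\<Pi>\<^sub>E i\<in>I. hcarrier (H i)). (\<lambda>i. (hnorm (H i) (f i))\<^sup>2) summable_on I},
     hadd = (\<lambda>f g. \<lambda>i\<in>I. hadd (H i) (f i) (g i)),
     hscale = (\<lambda>c f. \<lambda>i\<in>I. hscale (H i) c (f i)),
     hinner = (\<lambda>f g. \<Sum>\<^sub>\<infinity>i\<in>I. hinner (H i) (f i) (g i)) \<rparr>"

definition direct_sum_rep ::
  "'i set \<Rightarrow> ('i \<Rightarrow> 'h hilbert) \<Rightarrow> ('i \<Rightarrow> 'a::cstar_algebra \<Rightarrow> 'h \<Rightarrow> 'h)
    \<Rightarrow> 'a \<Rightarrow> ('i \<Rightarrow> 'h) \<Rightarrow> ('i \<Rightarrow> 'h)" where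
  "direct_sum_rep I H \<pi> a =
     (\<lambda>f\<in>hcarrier (direct_sum_space I H). \<lambda>i\<in>I. \<pi> i a (f i))"

definition faithful :: "('a::cstar_algebra \<Rightarrow> 'h \<Rightarrow> 'h) \<Rightarrow> bool" where
  "faithful \<pi> \<longleftrightarrow> inj \<pi>"

end

theory Submission
  imports Defs "HOL-Complex_Analysis.Cauchy_Integral_Formula" "HOL-Real_Asymp.Real_Asymp"
begin

text \<open>
  If \<open>\<rho>\<close> is injective on \<open>M\<close>, it is isometric there, so a state \<open>\<phi>\<close> of \<open>M\<close> can be transported
  to \<open>\<rho>(M)\<close>, extended to the target algebra by Hahn-Banach, and pulled back to a state of the
  whole algebra that extends \<open>\<phi>\<close> and vanishes on \<open>ker \<rho>\<close>. By uniqueness this is the given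
  extension. As \<open>ker \<rho>\<close> is an ideal, all the GNS representations vanish on it, and
  faithfulness of their sum gives \<open>ker \<rho> = 0\<close>.

  To avoid unitizations, functions of a self-adjoint element are operators acting on the
  algebra by left multiplication. The bound \<open>\<parallel>p(x)\<parallel> \<le> sup |p|\<close> for polynomials, on which the
  calculus rests, comes from writing a self-adjoint contraction as the mean of two unitaries.
\<close>

text \<open>The delicate point is that the Hahn-Banach functional must be positive. With a unit, a
  functional is positive as soon as its norm is its value at 1; so the extension is made on pairs
  \<open>(z, a)\<close> standing for z + a, below the operator norm of z + \<open>\<rho> a\<close>
  on the target. A bound that sees \<open>a\<close> only through \<open>\<rho> a\<close> also makes
  the functional vanish on the kernel. Two things must be supplied. For domination on the pairs over
  \<open>M\<close>, the state has to behave as if its value at 1 were 1; this comes from elements of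
  the unit ball of \<open>M\<close> on which it tends to 1, and from the isometry of
  \<open>\<rho>\<close> on \<open>M\<close>. To read positivity off the bound, one needs norm (T -
  \<open>star c * c\<close>) \<le> T for large T, that is, positivity of \<open>star c * c\<close>.
  Both the isometry and this positivity are drawn from a functional calculus on intervals around 0,
  so no Gelfand transform enters.\<close>

lemma scaleC_one [simp]: "1 *\<^sub>C x = (x :: 'a::complex_vector)"
  using scaleR_scaleC[of 1 x] by simp

lemma module_scaleC: "module (scaleC :: complex \<Rightarrow> 'a \<Rightarrow> 'a::complex_vector)"
  by unfold_locales (auto simp: scaleC_add_right scaleC_add_left scaleC_scaleC)

interpretation scaleC: module "scaleC :: complex \<Rightarrow> 'a \<Rightarrow> 'a::complex_vector"
  by (rule module_scaleC)

lemma scaleC_of_real: "complex_of_real r *\<^sub>C x = r *\<^sub>R x"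
  by (simp add: scaleR_scaleC)

lemma scaleC_scaleR_commute: "c *\<^sub>C (r *\<^sub>R x) = r *\<^sub>R (c *\<^sub>C x)"
  by (simp add: scaleR_scaleC scaleC_scaleC mult.commute)

lemma bounded_linear_scaleC: "bounded_linear (\<lambda>x :: 'a::cstar_algebra. c *\<^sub>C x)"
  by (rule bounded_linear_intro[where K = "cmod c"])
    (auto simp: scaleC_add_right scaleC_scaleR_commute norm_scaleC mult.commute)

lemma star_zero [simp]: "star (0 :: 'a::cstar_algebra) = 0"
  using star_add[of "0 :: 'a" 0] by simp

lemma star_minus: "star (- x :: 'a::cstar_algebra) = - star x"
  using star_add[of x "- x"] by (simp add: eq_neg_iff_add_eq_0 add.commute)

lemma star_diff: "star (x - y :: 'a::cstar_algebra) = star x - star y"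
  using star_add[of x "- y"] by (simp add: star_minus)

lemma star_scaleR: "star (r *\<^sub>R x :: 'a::cstar_algebra) = r *\<^sub>R star x"
  by (simp add: scaleR_scaleC star_scaleC)

lemmas star_simps = star_add star_minus star_diff star_scaleR star_scaleC star_mult star_star

lemma norm_le_norm_star: "norm x \<le> norm (star x :: 'a::cstar_algebra)"
proof (cases "x = 0")
  case False
  have "norm x * norm x \<le> norm (star x) * norm x"
    using norm_mult_ineq[of "star x" x] by (simp add: cstar_identity power2_eq_square)
  with False show ?thesis by simp
qed simp

lemma norm_star [simp]: "norm (star x :: 'a::cstar_algebra) = norm x"
  using norm_le_norm_star[of x] norm_le_norm_star[of "star x"] by (simp add: star_star)

lemma cstar_identity': "norm (x * star x :: 'a::cstar_algebra) = (norm x)\<^sup>2"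
  using cstar_identity[of "star x"] by (simp add: star_star)

lemma bounded_linear_star: "bounded_linear (star :: 'a::cstar_algebra \<Rightarrow> 'a)"
  by (rule bounded_linear_intro[where K = 1]) (auto simp: star_simps)

lemmas tendsto_star = bounded_linear.tendsto[OF bounded_linear_star]
lemmas continuous_on_star = bounded_linear.continuous_on[OF bounded_linear_star]

text \<open>Testing on b = \<open>star z\<close> recovers the norm from left multiplication; this
  takes the place of evaluation at 1 when passing from operators back to elements.\<close>

lemma norm_le_if_mult_le:
  fixes z :: "'a::cstar_algebra"
  assumes "\<And>b. norm (z * b) \<le> C * norm b" and "0 \<le> C"
  shows "norm z \<le> C"
proof (cases "z = 0")
  case False
  have "norm z * norm z \<le> C * norm z"
    using assms(1)[of "star z"] by (simp add: cstar_identity' power2_eq_square)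
  with False show ?thesis by simp
qed (use assms in simp)

subsection \<open>Polynomials in an operator\<close>

text \<open>Horner evaluation of p(T) at a vector, so that the constant term needs no unit. Scalars
  are generic because real polynomials in \<open>x\<close> and complex polynomials in a unitary both
  occur.\<close>

definition poly_act :: "('k::comm_ring_1 \<Rightarrow> 'v \<Rightarrow> 'v) \<Rightarrow> ('v \<Rightarrow> 'v) \<Rightarrow> 'k poly \<Rightarrow> 'v \<Rightarrow> 'v::ab_group_add" where
  "poly_act s T p b = fold_coeffs (\<lambda>a v. s a b + T v) p 0"

locale module_endo = module_hom s s T
  for s :: "'k::comm_ring_1 \<Rightarrow> 'v \<Rightarrow> 'v::ab_group_add" and T
begin

abbreviation act where "act \<equiv> poly_act s T"

lemma act_0 [simp]: "act 0 b = 0"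
  by (simp add: poly_act_def)

lemma act_pCons [simp]: "act (pCons a p) b = s a b + T (act p b)"
proof (cases "a = 0 \<and> p = 0")
  case False
  then show ?thesis
    by (cases "p = 0") (simp_all add: poly_act_def)
qed simp

lemma act_add_right: "act p (b + c) = act p b + act p c"
  by (induction p) (simp_all add: add m1.scale_right_distrib)

lemma act_scale_right: "act p (s r b) = s r (act p b)"
  by (induction p) (simp_all add: scale m1.scale_right_distrib mult.commute)

lemma act_commute: "act p (T b) = T (act p b)"
  by (induction p) (simp_all add: add scale)

lemma act_zero_right [simp]: "act p 0 = 0"
  by (induction p) simp_all

lemma act_add: "act (p + q) b = act p b + act q b"
proof (induction p arbitrary: q)
  case (pCons a p)
  obtain c r where q: "q = pCons c r" by (cases q)
  show ?case by (simp add: q pCons.IH add m1.scale_left_distrib)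
qed simp

lemma act_smult: "act (smult r p) b = s r (act p b)"
  by (induction p) (simp_all add: scale m1.scale_right_distrib)

lemma act_minus: "act (- p) b = - act p b"
  using act_smult[of "-1" p b] by (simp add: m1.scale_minus_left)

lemma act_diff: "act (p - q) b = act p b - act q b"
  using act_add[of p "- q" b] by (simp add: act_minus)

lemma act_mult: "act (p * q) b = act p (act q b)"
  by (induction p) (simp_all add: act_add act_smult)

lemma act_pcompose_linear:
  "poly_act s (\<lambda>v. s c (T v)) p b = act (pcompose p [:0, c:]) b"
proof -
  interpret cT: module_endo s "\<lambda>v. s c (T v)"
    by unfold_locales (simp_all add: add scale m1.scale_right_distrib mult.commute)
  show ?thesis
    by (induction p)
      (simp_all add: pcompose_pCons act_add act_smult scale)
qed

end

lemma poly_act_intertwine: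
  assumes "module_endo s T" "module_endo s' T'"
    and "\<And>v w. F (v + w) = F v + F w" "\<And>r v. F (s r v) = s' r (F v)"
    and "\<And>v. F (T v) = T' (F v)"
  shows "F (poly_act s T p b) = poly_act s' T' p (F b)"
proof -
  interpret T: module_endo s T by fact
  interpret T': module_endo s' T' by fact
  have "F 0 = 0" using assms(3)[of 0 0] by simp
  then show ?thesis
    by (induction p) (simp_all add: assms(3-5))
qed

lemma module_endo_times: "module_endo scaleR ((*) (x :: 'a::cstar_algebra))"
  by unfold_locales (simp_all add: algebra_simps)

text \<open>Cauchy's inequality for the k-th derivative at 0, on the circle of radius 1.\<close>

lemma norm_coeff_le_of_unit_circle:
  fixes h :: "complex poly"
  assumes "\<And>z. cmod z = 1 \<Longrightarrow> cmod (poly h z) \<le> C"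
  shows "cmod (coeff h k) \<le> C"
proof -
  have "deriv (poly q) = poly (pderiv q)" for q :: "complex poly"
    by (intro ext DERIV_imp_deriv poly_DERIV)
  then have "(deriv ^^ k) (poly h) = poly ((pderiv ^^ k) h)"
    by (induction k) simp_all
  then have "(deriv ^^ k) (poly h) 0 = fact k * coeff h k"
    by (simp add: poly_0_coeff_0 coeff_higher_pderiv pochhammer_fact)
  moreover have "cmod ((deriv ^^ k) (poly h) 0) \<le> fact k * C / 1 ^ k"
    by (rule Cauchy_inequality)
      (use assms in \<open>auto intro!: holomorphic_intros continuous_intros\<close>)
  ultimately show ?thesis by (simp add: norm_mult)
qed

text \<open>Powers of an isometry preserve norms, so the sum of the moduli of the coefficients is a
  bound, and each of them is at most \<open>C\<close>.\<close>

lemma norm_poly_act_isometry_le: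
  fixes T :: "'a::cstar_algebra \<Rightarrow> 'a"
  assumes "module_endo scaleC T" and iso: "\<And>b. norm (T b) = norm b"
    and C: "\<And>z. cmod z = 1 \<Longrightarrow> cmod (poly h z) \<le> C" and deg: "degree h \<le> n"
  shows "norm (poly_act scaleC T h b) \<le> (real n + 1) * C * norm b"
proof -
  interpret module_endo scaleC T by fact
  have "norm (act h b) \<le> (\<Sum>c\<leftarrow>coeffs h. cmod c) * norm b"
  proof (induction h)
    case (pCons a p)
    have "norm (act (pCons a p) b) \<le> cmod a * norm b + norm (act p b)"
      by (simp, rule order_trans[OF norm_triangle_ineq]) (simp add: norm_scaleC iso)
    also have "\<dots> \<le> cmod a * norm b + (\<Sum>c\<leftarrow>coeffs p. cmod c) * norm b"
      using pCons.IH by simp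
    finally show ?case
      using pCons.hyps by (simp add: cCons_def algebra_simps)
  qed simp
  also have "(\<Sum>c\<leftarrow>coeffs h. cmod c) \<le> (\<Sum>c\<leftarrow>coeffs h. C)"
    by (rule sum_list_mono)
      (use norm_coeff_le_of_unit_circle[OF C] in \<open>auto simp: coeffs_def split: if_splits\<close>)
  also have "\<dots> \<le> (real n + 1) * C"
  proof -
    have "0 \<le> C" using C[of 1] norm_ge_zero order_trans by (metis norm_one)
    moreover have "length (coeffs h) \<le> n + 1"
      using deg by (simp add: coeffs_def)
    ultimately show ?thesis
      by (simp add: sum_list_triv mult_right_mono flip: of_nat_Suc)
  qed
  finally show ?thesis by (simp add: mult_right_mono)
qed

subsection \<open>Norms of polynomials in a self-adjoint element\<close>

text \<open>The element \<open>s\<close> plays the role of 1 - sqrt (1 - x^2), which makes sense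
  without a unit. It is the fixed point of s \<mapsto> (x^2 + s^2) / 2, a contraction with constant
  \<open>norm x\<close> on the self-adjoint elements of norm at most \<open>norm x\<close> that
  commute with \<open>x\<close>.\<close>

lemma ex_sqrt_complement:
  fixes x :: "'a::cstar_algebra"
  assumes x: "star x = x" "norm x < 1"
  shows "\<exists>s. star s = s \<and> x * s = s * x \<and> s + s = x * x + s * s"
proof -
  define S where "S = {s. star s = s \<and> x * s = s * x \<and> norm s \<le> norm x}"
  define f where "f s = (1/2) *\<^sub>R (x * x + s * s)" for s :: 'a
  have "\<exists>!s. s \<in> S \<and> f s = s"
  proof (rule Banach_fix)
    have "closed S"
      unfolding S_def
      by (intro closed_Collect_conj closed_Collect_eq closed_Collect_le
          continuous_intros continuous_on_star)
    then show "complete S" by (simp add: complete_eq_closed)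
    show "S \<noteq> {}" unfolding S_def by (auto intro!: exI[of _ 0])
    show "0 \<le> norm x" "norm x < 1" using x by auto
    show "f ` S \<subseteq> S"
    proof safe
      fix s assume s: "s \<in> S"
      have "norm (f s) \<le> (1/2) * (norm x * norm x + norm s * norm s)"
        unfolding f_def
        by (simp add: order_trans[OF norm_triangle_ineq add_mono[OF norm_mult_ineq norm_mult_ineq]])
      also have "\<dots> \<le> (1/2) * (norm x * 1 + norm x * 1)"
        using s x by (intro mult_left_mono add_mono mult_mono) (auto simp: S_def)
      finally have "norm (f s) \<le> norm x" by simp
      moreover have "x * s = s * x" using s by (simp add: S_def)
      then have "x * (s * s) = s * s * x" by (metis mult.assoc)
      then have "x * f s = f s * x"
        by (simp add: f_def distrib_left distrib_right mult.assoc)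
      moreover have "star (f s) = f s"
        using s x by (simp add: f_def S_def star_simps)
      ultimately show "f s \<in> S" by (simp add: S_def)
    qed
    fix s t assume s: "s \<in> S" and t: "t \<in> S"
    \<comment> \<open>This form of s^2 - t^2 holds although \<open>s\<close> and \<open>t\<close>
      need not commute.\<close>
    have "f s - f t = (1/2) *\<^sub>R (s * (s - t) + (s - t) * t)"
      by (simp add: f_def algebra_simps)
    then have "norm (f s - f t) \<le> (1/2) * (norm s * norm (s - t) + norm (s - t) * norm t)"
      by (simp add: order_trans[OF norm_triangle_ineq add_mono[OF norm_mult_ineq norm_mult_ineq]])
    also have "\<dots> \<le> (1/2) * (norm x * norm (s - t) + norm (s - t) * norm x)"
      using s t by (intro mult_left_mono add_mono mult_right_mono) (auto simp: S_def)
    finally show "dist (f s) (f t) \<le> norm x * dist s t"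
      by (simp add: dist_norm)
  qed
  then obtain s where s: "s \<in> S" "f s = s" by blast
  have "s + s = (2::real) *\<^sub>R f s" by (simp only: s(2) scaleR_2)
  then have "s + s = x * x + s * s" by (simp add: f_def)
  with s show ?thesis by (auto simp: S_def)
qed

text \<open>
  Since \<open>x\<^sup>2 + (1 - s)\<^sup>2 = 1\<close>, the operators \<open>U = x + i (1 - s)\<close> and \<open>V = x - i (1 - s)\<close> are
  unitaries with mean \<open>x\<close>. They act on the algebra by left multiplication, which makes
  sense without a unit.
\<close>

locale sqrt_complement =
  fixes x s :: "'a::cstar_algebra"
  assumes star_x: "star x = x" and star_s: "star s = s" and comm: "x * s = s * x"
    and eq: "s + s = x * x + s * s"
begin

definition U :: "'a \<Rightarrow> 'a" where "U b = x * b + \<i> *\<^sub>C (b - s * b)"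
definition V :: "'a \<Rightarrow> 'a" where "V b = x * b - \<i> *\<^sub>C (b - s * b)"

lemma comm': "x * (s * b) = s * (x * b)"
  by (metis comm mult.assoc)

lemma eq': "s * b + s * b = x * (x * b) + s * (s * b)"
  using arg_cong[OF eq, of "\<lambda>v. v * b"] by (simp add: distrib_right mult.assoc)

lemma UV: "U (V b) = b"
  using eq'[of b]
  by (simp add: U_def V_def algebra_simps comm' mult_scaleC_right scaleC.scale_right_diff_distrib
      scaleC_add_right scaleC_scaleC)

lemma VU: "V (U b) = b"
  using eq'[of b]
  by (simp add: U_def V_def algebra_simps comm' mult_scaleC_right scaleC.scale_right_diff_distrib
      scaleC_add_right scaleC_scaleC)

text \<open>\<open>V\<close> is the adjoint of \<open>U\<close> for the algebra-valued form
  \<open>star b * c\<close>; together with \<open>VU\<close> this makes \<open>U\<close>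
  isometric.\<close>

lemma star_U: "star (U b) * c = star b * V c"
  by (simp add: U_def V_def star_simps star_x star_s algebra_simps mult_scaleC_right
      mult_scaleC_left scaleC.scale_right_diff_distrib scaleC_add_right)

lemma norm_U: "norm (U b) = norm b"
  using cstar_identity[of "U b"] cstar_identity[of b] by (simp add: star_U VU)

lemma norm_V: "norm (V b) = norm b"
  using norm_U[of "V b"] by (simp add: UV)

lemma mean: "x * b = (1/2) *\<^sub>R (U b + V b)"
  by (simp add: U_def V_def flip: scaleR_add_right scaleR_2)

text \<open>The algebraic relations between \<open>x\<close> and \<open>s\<close> alone force the
  bound, and such relations survive homomorphisms.\<close>

lemma norm_le_1: "norm x \<le> 1"
proof (rule norm_le_if_mult_le)
  fix b show "norm (x * b) \<le> 1 * norm b"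
    using norm_triangle_ineq[of "U b" "V b"] by (simp add: mean norm_U norm_V)
qed simp

lemma U_x: "U (x * b) = x * U b"
  by (simp add: U_def algebra_simps comm' mult_scaleC_right)

lemma module_endo_U: "module_endo scaleC U"
  by unfold_locales
    (simp_all add: U_def algebra_simps mult_scaleC_right scaleC.scale_right_diff_distrib
      mult.commute)

sublocale U: module_endo scaleC U
  by (rule module_endo_U)

sublocale X: module_endo scaleR "(*) x"
  by (rule module_endo_times)

text \<open>The relation U x = (1 + U^2) / 2, from x = (U + V) / 2 and U V = 1, turns multiplication
  by \<open>x\<close> into a polynomial in \<open>U\<close>.\<close>

lemma U_quadratic: "poly_act scaleC U [:1/2, 0, 1/2:] b = U (x * b)"
proof -
  have "U (x * b) = (1/2) *\<^sub>R (U (U b) + b)"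
    by (simp add: mean scaleR_scaleC U.add U.scale UV)
  then show ?thesis
    by (simp add: scaleR_scaleC scaleC_add_right add.commute U.scale)
qed

text \<open>
  With \<open>x = (U + U\<^sup>-\<^sup>1) / 2\<close>, the operator \<open>U\<^sup>n p(x)\<close> is a polynomial in \<open>U\<close>. On the
  unit circle this is the substitution \<open>Re z = (z + z\<^sup>-\<^sup>1) / 2\<close>.
\<close>

lemma ex_laurent:
  "degree p \<le> n \<Longrightarrow> \<exists>h. degree h \<le> 2 * n
      \<and> (\<forall>z. cmod z = 1 \<longrightarrow> poly h z = z ^ n * of_real (poly p (Re z)))
      \<and> (\<forall>b. poly_act scaleC U h b = (U ^^ n) (poly_act scaleR ((*) x) p b))"
proof (induction n arbitrary: p)
  case 0
  then obtain a where "p = [:a:]" by (metis degree_eq_zeroE le_zero_eq)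
  then show ?case
    by (intro exI[of _ "[:of_real a:]"]) (simp add: scaleC_of_real)
next
  case (Suc n)
  obtain a q where p: "p = pCons a q" by (cases p)
  with Suc.prems have "degree q \<le> n" by (cases "q = 0") auto
  from Suc.IH[OF this] obtain h where h: "degree h \<le> 2 * n"
    and poly_h: "\<And>z. cmod z = 1 \<Longrightarrow> poly h z = z ^ n * of_real (poly q (Re z))"
    and act_h: "\<And>b. U.act h b = (U ^^ n) (X.act q b)" by blast
  \<comment> \<open>Since p = a + t q, U^(n+1) p(x) = a U^(n+1) + (U x) U^n q(x), and U x is the
    quadratic polynomial of \<open>U_quadratic\<close>.\<close>
  define h' where "h' = monom (of_real a) (Suc n) + [:1/2, 0, 1/2:] * h"
  have "degree h' \<le> 2 * Suc n"
    unfolding h'_def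
    by (rule degree_add_le[OF order_trans[OF degree_monom_le]
          order_trans[OF degree_mult_le]]) (use h in auto)
  moreover have "poly h' z = z ^ Suc n * of_real (poly p (Re z))" if "cmod z = 1" for z
  proof -
    have "z * of_real (Re z) = 1/2 + z * (z * (1/2))"
      using that by (simp add: complex_eq_iff cmod_def power2_eq_square algebra_simps)
        (simp add: field_simps)
    then have "z ^ n * (z * of_real (Re z)) * of_real (poly q (Re z))
        = z ^ n * (1/2 + z * (z * (1/2))) * of_real (poly q (Re z))" by simp
    then show ?thesis
      by (simp add: h'_def p poly_monom poly_h[OF that] algebra_simps)
  qed
  moreover have "U.act h' b = (U ^^ Suc n) (X.act p b)" for b
  proof -
    have monom: "U.act (monom c k) v = c *\<^sub>C (U ^^ k) v" for c k v
      by (induction k) (simp_all add: monom_0 monom_Suc U.scale)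
    have pow: "(U ^^ k) (v + w) = (U ^^ k) v + (U ^^ k) w"
      "(U ^^ k) (c *\<^sub>C v) = c *\<^sub>C (U ^^ k) v" "(U ^^ k) (x * v) = x * (U ^^ k) v" for c k v w
      by (induction k) (simp_all add: U.add U.scale U_x)
    show ?thesis
      unfolding h'_def U.act_add U.act_mult U_quadratic act_h monom
      by (simp add: p pow U.add U.scale U_x flip: scaleC_of_real)
  qed
  ultimately show ?case by blast
qed

lemma norm_act_le_degree:
  assumes "\<And>t. \<bar>t\<bar> \<le> 1 \<Longrightarrow> \<bar>poly p t\<bar> \<le> C"
  shows "norm (poly_act scaleR ((*) x) p b) \<le> (2 * real (degree p) + 1) * C * norm b"
proof -
  obtain h where h: "degree h \<le> 2 * degree p"
    and poly_h: "\<And>z. cmod z = 1 \<Longrightarrow> poly h z = z ^ degree p * of_real (poly p (Re z))"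
    and act_h: "\<And>b. U.act h b = (U ^^ degree p) (X.act p b)"
    using ex_laurent[of p "degree p"] by blast
  have pow: "norm ((U ^^ k) v) = norm v" for k v
    by (induction k) (simp_all add: norm_U)
  have "norm (U.act h b) \<le> (real (2 * degree p) + 1) * C * norm b"
  proof (rule norm_poly_act_isometry_le[OF module_endo_U norm_U _ h])
    fix z :: complex assume z: "cmod z = 1"
    then show "cmod (poly h z) \<le> C"
      using assms[of "Re z"] abs_Re_le_cmod[of z]
      by (simp add: poly_h norm_mult norm_power)
  qed
  then show ?thesis by (simp add: act_h pow)
qed

end

lemma star_poly_act:
  fixes x :: "'a::cstar_algebra"
  assumes "star x = x"
  shows "star (poly_act scaleR ((*) x) p b) * c = star b * poly_act scaleR ((*) x) p c"
proof -
  interpret module_endo scaleR "(*) x" by (rule module_endo_times)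
  show ?thesis
  proof (induction p arbitrary: c)
    case (pCons a p)
    have "star (x * act p b) * c = star b * act p (x * c)"
      using pCons.IH[of "x * c"] by (simp add: star_mult assms mult.assoc)
    then show ?case
      by (simp add: star_simps distrib_left distrib_right act_commute)
  qed simp
qed

lemma le_one_if_power_le_linear:
  fixes a :: real
  assumes "\<And>k. a ^ (2 ^ k) \<le> c * 2 ^ k + d"
  shows "a \<le> 1"
proof (rule ccontr)
  assume "\<not> a \<le> 1"
  then have "filterlim (\<lambda>n. a ^ n - (c * real n + d)) at_top sequentially"
    by real_asymp
  then have "eventually (\<lambda>n. 0 < a ^ n - (c * real n + d)) sequentially"
    by (simp only: filterlim_at_top_dense)
  then obtain N where N: "\<And>n. n \<ge> N \<Longrightarrow> c * real n + d < a ^ n"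
    by (auto simp: eventually_sequentially)
  have "N \<le> 2 ^ N" by (simp add: less_imp_le)
  then show False using N[of "2 ^ N"] assms[of N] by simp
qed

text \<open>
  The bound by \<open>2 deg p + 1\<close> is applied to \<open>p ^ (2 ^ k)\<close>: the operator \<open>p(x)\<close> is
  self-adjoint, so the norm of its \<open>2\<^sup>k\<close>-th power is the \<open>2\<^sup>k\<close>-th power of its norm, and
  the linear factor disappears in the limit.
\<close>

lemma norm_poly_act_le_1:
  fixes x :: "'a::cstar_algebra"
  assumes x: "star x = x" "norm x < 1" and C: "\<And>t. \<bar>t\<bar> \<le> 1 \<Longrightarrow> \<bar>poly p t\<bar> \<le> C" "0 < C"
  shows "norm (poly_act scaleR ((*) x) p b) \<le> C * norm b"
proof (cases "b = 0")
  case True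
  interpret module_endo scaleR "(*) x" by (rule module_endo_times)
  show ?thesis by (simp add: True)
next
  case False
  obtain s where "star s = s" "x * s = s * x" "s + s = x * x + s * s"
    using ex_sqrt_complement[OF x] by blast
  then interpret sqrt_complement x s
    by unfold_locales (use x in auto)
  have sq: "(norm (X.act q b))\<^sup>2 \<le> norm b * norm (X.act (q * q) b)" for q
    using norm_mult_ineq[of "star b" "X.act (q * q) b"]
    by (simp add: cstar_identity[symmetric] star_poly_act[OF x(1)] X.act_mult)
  \<comment> \<open>The vector stays fixed while \<open>sq\<close> is iterated, so the squarings
    accumulate factors \<open>norm b\<close>; dividing by \<open>C * norm b\<close> below absorbs
    them together with the powers of \<open>C\<close>.\<close>
  have pow: "norm (X.act q b) ^ (2 ^ k) * norm b \<le> norm b ^ (2 ^ k) * norm (X.act (q ^ (2 ^ k)) b)"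
    for k q
  proof (induction k arbitrary: q)
    case (Suc k)
    have "norm (X.act q b) ^ (2 ^ Suc k) * norm b = ((norm (X.act q b))\<^sup>2) ^ (2 ^ k) * norm b"
      by (simp add: power_mult)
    also have "\<dots> \<le> (norm b * norm (X.act (q * q) b)) ^ (2 ^ k) * norm b"
      by (intro mult_right_mono power_mono sq) simp_all
    also have "\<dots> = norm b ^ (2 ^ k) * (norm (X.act (q * q) b) ^ (2 ^ k) * norm b)"
      by (simp add: power_mult_distrib)
    also have "\<dots> \<le> norm b ^ (2 ^ k) * (norm b ^ (2 ^ k) * norm (X.act ((q * q) ^ (2 ^ k)) b))"
      by (intro mult_left_mono Suc.IH) simp
    also have "\<dots> = norm b ^ (2 ^ Suc k) * norm (X.act (q ^ (2 ^ Suc k)) b)"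
      by (simp add: power_mult mult.assoc power2_eq_square flip: power_add)
        (simp add: mult_2 power_add power_mult_distrib)
    finally show ?case .
  qed simp
  define a where "a = norm (X.act p b) / (C * norm b)"
  have "a ^ (2 ^ k) \<le> (2 * real (degree p)) * 2 ^ k + 1" for k
  proof -
    let ?N = "2 ^ k :: nat"
    have "norm (X.act (p ^ ?N) b) \<le> (2 * real (degree (p ^ ?N)) + 1) * C ^ ?N * norm b"
      by (rule norm_act_le_degree) (simp add: C power_abs power_mono)
    also have "\<dots> \<le> (2 * real (degree p * ?N) + 1) * C ^ ?N * norm b"
      using degree_power_le[of p ?N] C
      by (intro mult_right_mono) (auto simp del: of_nat_mult of_nat_power)
    finally have "norm (X.act p b) ^ ?N * norm b
        \<le> norm b ^ ?N * ((2 * real (degree p * ?N) + 1) * C ^ ?N * norm b)"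
      by (meson pow mult_left_mono norm_ge_zero order_trans zero_le_power)
    then have "norm (X.act p b) ^ ?N \<le> (2 * real (degree p * ?N) + 1) * (C * norm b) ^ ?N"
      using False by (simp add: power_mult_distrib mult_ac)
    then show ?thesis
      using False C by (simp add: a_def power_divide divide_le_eq mult.assoc)
  qed
  then have "a \<le> 1" by (rule le_one_if_power_le_linear)
  then show ?thesis using False C by (simp add: a_def divide_le_eq)
qed

lemma norm_poly_act_le:
  fixes x :: "'a::cstar_algebra"
  assumes x: "star x = x" "norm x < R" and C: "\<And>t. \<bar>t\<bar> \<le> R \<Longrightarrow> \<bar>poly p t\<bar> \<le> C"
  shows "norm (poly_act scaleR ((*) x) p b) \<le> C * norm b"
proof -
  have R: "0 < R" using x(2) norm_ge_zero le_less_trans by blast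
  have C0: "0 \<le> C" using C[of 0] R by simp
  let ?y = "(1 / R) *\<^sub>R x" and ?q = "pcompose p [:0, R:]"
  interpret y: module_endo scaleR "(*) ?y" by (rule module_endo_times)
  have "((*) x) = (\<lambda>v. R *\<^sub>R (?y * v))" using R by auto
  then have act: "poly_act scaleR ((*) x) p b = y.act ?q b"
    using y.act_pcompose_linear[of R p b] by simp
  \<comment> \<open>The bound to be used requires a positive constant and \<open>C\<close> may be 0;
    hence every C' > C is taken, followed by a limit.\<close>
  have "norm (y.act ?q b) \<le> C' * norm b" if "C < C'" for C'
  proof (rule norm_poly_act_le_1)
    show "star ?y = ?y" "norm ?y < 1" using x R by (auto simp: star_scaleR)
    show "\<bar>poly ?q t\<bar> \<le> C'" if "\<bar>t\<bar> \<le> 1" for t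
      using C[of "t * R"] that \<open>C < C'\<close> R mult_right_mono[of "\<bar>t\<bar>" 1 R]
      by (simp add: poly_pcompose abs_mult mult.commute)
  qed (use C0 that in simp)
  note bound = this
  show ?thesis
  proof (cases "b = 0")
    case True
    interpret module_endo scaleR "(*) x" by (rule module_endo_times)
    show ?thesis by (simp add: True)
  next
    case False
    have "norm (y.act ?q b) / norm b \<le> C'" if "C < C'" for C'
      using bound[OF that] False by (subst pos_divide_le_eq) auto
    then have "norm (y.act ?q b) / norm b \<le> C" by (rule dense_ge)
    then show ?thesis
      unfolding act using False by (subst (asm) pos_divide_le_eq) auto
  qed
qed

subsection \<open>Homomorphisms are contractive\<close>

text \<open>A complement \<open>s\<close> of \<open>x\<close> is carried to a complement of
  \<open>\<rho> x\<close>, so \<open>norm_le_1\<close> applies in the target.\<close>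

lemma norm_hom_self_adjoint_le_1:
  fixes \<rho> :: "'a::cstar_algebra \<Rightarrow> 'b::cstar_algebra"
  assumes "cstar_hom \<rho>" "star x = x" "norm x < 1"
  shows "norm (\<rho> x) \<le> 1"
proof -
  obtain s where s: "star s = s" "x * s = s * x" "s + s = x * x + s * s"
    using ex_sqrt_complement assms by blast
  have \<rho>: "\<rho> (a + b) = \<rho> a + \<rho> b" "\<rho> (a * b) = \<rho> a * \<rho> b" "\<rho> (star a) = star (\<rho> a)" for a b
    using assms(1) by (auto simp: cstar_hom_def)
  interpret sqrt_complement "\<rho> x" "\<rho> s"
    by unfold_locales (metis \<rho> assms(2) s)+
  show ?thesis by (rule norm_le_1)
qed

locale cstar_homomorphism =
  fixes \<rho> :: "'a::cstar_algebra \<Rightarrow> 'b::cstar_algebra"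
  assumes cstar_hom: "cstar_hom \<rho>"
begin

lemma hom_add: "\<rho> (x + y) = \<rho> x + \<rho> y"
  and hom_scaleC: "\<rho> (c *\<^sub>C x) = c *\<^sub>C \<rho> x"
  and hom_mult: "\<rho> (x * y) = \<rho> x * \<rho> y"
  and hom_star: "\<rho> (star x) = star (\<rho> x)"
  using cstar_hom by (auto simp: cstar_hom_def)

lemma hom_scaleR: "\<rho> (r *\<^sub>R x) = r *\<^sub>R \<rho> x"
  by (simp add: scaleR_scaleC hom_scaleC)

lemma norm_hom_le: "norm (\<rho> x) \<le> norm x"
proof -
  have sa: "norm (\<rho> y) \<le> norm y" if y: "star y = y" for y
  proof (rule dense_ge)
    fix r assume r: "norm y < r"
    then have "0 < r" using norm_ge_zero le_less_trans by blast
    have "norm (\<rho> ((1 / r) *\<^sub>R y)) \<le> 1"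
      by (rule norm_hom_self_adjoint_le_1[OF cstar_hom])
        (use y r \<open>0 < r\<close> in \<open>auto simp: star_scaleR\<close>)
    then show "norm (\<rho> y) \<le> r" using \<open>0 < r\<close> by (simp add: hom_scaleR)
  qed
  have "(norm (\<rho> x))\<^sup>2 = norm (\<rho> (star x * x))"
    by (simp add: hom_mult hom_star cstar_identity)
  also have "\<dots> \<le> (norm x)\<^sup>2"
    using sa[of "star x * x"] by (simp add: star_simps cstar_identity)
  finally show ?thesis by (rule power2_le_imp_le) simp
qed

lemma bounded_linear_hom: "bounded_linear \<rho>"
  by (rule bounded_linear_intro[where K = 1]) (auto simp: hom_add hom_scaleR norm_hom_le)

sublocale hom: bounded_linear \<rho>
  by (rule bounded_linear_hom)

lemma hom_poly_act:
  "\<rho> (poly_act scaleR ((*) x) p b) = poly_act scaleR ((*) (\<rho> x)) p (\<rho> b)"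
  by (rule poly_act_intertwine[OF module_endo_times module_endo_times])
    (auto simp: hom_add hom_scaleR hom_mult)

end

subsection \<open>Continuous functional calculus\<close>

lemma bounded_linear_poly_act:
  "bounded_linear (poly_act scaleR ((*) (x :: 'a::cstar_algebra)) p)"
proof -
  interpret module_endo scaleR "(*) x" by (rule module_endo_times)
  have "\<exists>K. \<forall>b. norm (act p b) \<le> norm b * K"
  proof (induction p)
    case (pCons a p)
    then obtain K where K: "\<And>b. norm (act p b) \<le> norm b * K" by blast
    have "norm (act (pCons a p) b) \<le> norm b * (\<bar>a\<bar> + norm x * K)" for b
    proof -
      have "norm (x * act p b) \<le> norm x * (norm b * K)"
        by (rule order_trans[OF norm_mult_ineq mult_left_mono[OF K norm_ge_zero]])
      then have "norm (a *\<^sub>R b + x * act p b) \<le> \<bar>a\<bar> * norm b + norm x * (norm b * K)"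
        by (intro order_trans[OF norm_triangle_ineq]) simp
      then show ?thesis by (simp add: algebra_simps)
    qed
    then show ?case by blast
  qed (auto intro: exI[of _ 0])
  then show ?thesis
    by (auto intro: bounded_linear_intro simp: act_add_right act_scale_right)
qed

lemma ex_poly_approx:
  fixes g :: "real \<Rightarrow> real"
  assumes "continuous_on UNIV g" "0 < e"
  obtains p where "\<And>t. \<bar>t\<bar> \<le> R \<Longrightarrow> \<bar>g t - poly p t\<bar> \<le> e"
proof -
  obtain q where q: "real_polynomial_function q" "\<And>t. t \<in> {-R..R} \<Longrightarrow> \<bar>g t - q t\<bar> < e"
    using Stone_Weierstrass_real_polynomial_function[OF compact_Icc _ assms(2), of "-R" R g]
      continuous_on_subset[OF assms(1)] by blast
  obtain a n where a: "q = (\<lambda>t. \<Sum>i\<le>n. a i * t ^ i)"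
    using q(1) by (auto simp: real_polynomial_function_iff_sum)
  show thesis
  proof (rule that)
    show "\<bar>g t - poly (\<Sum>i\<le>n. monom (a i) i) t\<bar> \<le> e" if "\<bar>t\<bar> \<le> R" for t
    proof -
      have "t \<in> {-R..R}" using that by auto
      from q(2)[OF this] show ?thesis by (simp add: a poly_sum poly_monom)
    qed
  qed
qed

lemma continuous_bounded_on_interval:
  fixes g :: "real \<Rightarrow> real"
  assumes "continuous_on UNIV g"
  obtains C where "\<And>t. \<bar>t\<bar> \<le> R \<Longrightarrow> \<bar>g t\<bar> \<le> C"
proof -
  have "bounded (g ` {-R..R})"
    by (intro compact_imp_bounded compact_continuous_image continuous_on_subset[OF assms]) auto
  then obtain C where C: "\<And>t. t \<in> {-R..R} \<Longrightarrow> \<bar>g t\<bar> \<le> C"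
    unfolding bounded_iff by (metis imageI real_norm_def)
  show thesis by (rule that[of C], rule C) auto
qed

text \<open>
  There need not be a unit, so \<open>g(x)\<close> is an operator on the algebra and \<open>cfc x g b\<close> is its
  value \<open>g(x) b\<close>. It is junk unless \<open>x\<close> is self-adjoint and \<open>g\<close> is continuous.
\<close>

definition cfc :: "'a::cstar_algebra \<Rightarrow> (real \<Rightarrow> real) \<Rightarrow> 'a \<Rightarrow> 'a" where
  "cfc x g b = (SOME y. \<forall>R>norm x. \<forall>e p. (\<forall>t. \<bar>t\<bar> \<le> R \<longrightarrow> \<bar>g t - poly p t\<bar> \<le> e)
     \<longrightarrow> norm (y - poly_act scaleR ((*) x) p b) \<le> e * norm b)"

locale self_adjoint =
  fixes x :: "'a::cstar_algebra"
  assumes star_self: "star x = x"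
begin

sublocale X: module_endo scaleR "(*) x"
  by (rule module_endo_times)

lemma norm_diff_act_le:
  assumes "norm x < R"
    and "\<And>t. \<bar>t\<bar> \<le> R \<Longrightarrow> \<bar>g t - poly p t\<bar> \<le> e" "\<And>t. \<bar>t\<bar> \<le> R \<Longrightarrow> \<bar>g t - poly q t\<bar> \<le> e'"
  shows "norm (X.act p b - X.act q b) \<le> (e + e') * norm b"
  unfolding X.act_diff[symmetric]
proof (rule norm_poly_act_le[OF star_self assms(1)])
  show "\<bar>poly (p - q) t\<bar> \<le> e + e'" if "\<bar>t\<bar> \<le> R" for t
    using assms(2,3)[OF that] by simp
qed

text \<open>Existence of the value chosen in \<open>cfc\<close>: polynomial approximants on one
  interval are Cauchy at \<open>b\<close>, and their limit satisfies the defining bound for all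
  admissible intervals.\<close>

lemma norm_cfc_diff_act_le:
  assumes g: "continuous_on UNIV g" and R: "norm x < R"
    and e: "\<And>t. \<bar>t\<bar> \<le> R \<Longrightarrow> \<bar>g t - poly p t\<bar> \<le> e"
  shows "norm (cfc x g b - X.act p b) \<le> e * norm b"
proof -
  let ?R = "norm x + 1"
  have "\<exists>p. \<forall>t. \<bar>t\<bar> \<le> ?R \<longrightarrow> \<bar>g t - poly p t\<bar> \<le> inverse (real (Suc k))" for k
    using ex_poly_approx[OF g, of "inverse (real (Suc k))"] by (metis inverse_positive_iff_positive of_nat_0_less_iff zero_less_Suc)
  then obtain P where P: "\<And>k t. \<bar>t\<bar> \<le> ?R \<Longrightarrow> \<bar>g t - poly (P k) t\<bar> \<le> inverse (real (Suc k))"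
    by metis
  have lim0: "(\<lambda>k. (inverse (real (Suc k)) + d) * norm b) \<longlonglongrightarrow> (0 + d) * norm b" for d
    by (intro tendsto_intros LIMSEQ_inverse_real_of_nat)
  have "Cauchy (\<lambda>k. X.act (P k) b)"
  proof (rule metric_CauchyI)
    fix d :: real assume "0 < d"
    have "eventually (\<lambda>k. (inverse (real (Suc k)) + 0) * norm b < d / 2) sequentially"
      using lim0[of 0] \<open>0 < d\<close> by (intro order_tendstoD(2)) auto
    then obtain N where N: "\<And>k. N \<le> k \<Longrightarrow> inverse (real (Suc k)) * norm b < d / 2"
      by (auto simp: eventually_sequentially)
    have "dist (X.act (P m) b) (X.act (P n) b) < d" if "N \<le> m" "N \<le> n" for m n
      using norm_diff_act_le[of ?R g "P m" _ "P n" _ b, OF _ P P] N[OF that(1)] N[OF that(2)]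
      by (simp add: dist_norm distrib_right)
    then show "\<exists>N. \<forall>m\<ge>N. \<forall>n\<ge>N. dist (X.act (P m) b) (X.act (P n) b) < d" by blast
  qed
  then obtain y where y: "(\<lambda>k. X.act (P k) b) \<longlonglongrightarrow> y"
    using Cauchy_convergent convergent_def by blast
  have "norm (y - X.act q b) \<le> d * norm b"
    if "norm x < S" and q: "\<And>t. \<bar>t\<bar> \<le> S \<Longrightarrow> \<bar>g t - poly q t\<bar> \<le> d" for S d q
  proof (rule LIMSEQ_le)
    show "(\<lambda>k. norm (X.act (P k) b - X.act q b)) \<longlonglongrightarrow> norm (y - X.act q b)"
      by (intro tendsto_intros y)
    show "(\<lambda>k. (inverse (real (Suc k)) + d) * norm b) \<longlonglongrightarrow> d * norm b"
      using lim0 by simp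
    \<comment> \<open>The two approximations live on different intervals; the smaller one still
      exceeds \<open>norm x\<close>.\<close>
    show "\<exists>N. \<forall>k\<ge>N. norm (X.act (P k) b - X.act q b) \<le> (inverse (real (Suc k)) + d) * norm b"
      by (intro exI[of _ 0] allI impI norm_diff_act_le[of "min S ?R" g]) (use that P in auto)
  qed
  then have "\<exists>y. \<forall>R>norm x. \<forall>e p. (\<forall>t. \<bar>t\<bar> \<le> R \<longrightarrow> \<bar>g t - poly p t\<bar> \<le> e)
     \<longrightarrow> norm (y - X.act p b) \<le> e * norm b" by blast
  from someI_ex[OF this] show ?thesis
    using R e unfolding cfc_def by blast
qed

lemma cfc_tendsto:
  assumes "continuous_on UNIV g" "norm x < R"
    and "\<And>k t. \<bar>t\<bar> \<le> R \<Longrightarrow> \<bar>g t - poly (P k) t\<bar> \<le> e k" "e \<longlonglongrightarrow> 0"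
  shows "(\<lambda>k. X.act (P k) b) \<longlonglongrightarrow> cfc x g b"
proof -
  have "(\<lambda>k. X.act (P k) b - cfc x g b) \<longlonglongrightarrow> 0"
  proof (rule tendsto_norm_zero_cancel, rule tendsto_sandwich[OF _ _ tendsto_const])
    show "(\<lambda>k. e k * norm b) \<longlonglongrightarrow> 0"
      using tendsto_mult_right[OF assms(4), of "norm b"] by simp
    show "eventually (\<lambda>k. norm (X.act (P k) b - cfc x g b) \<le> e k * norm b) sequentially"
      using norm_cfc_diff_act_le[OF assms(1-3)] by (simp add: norm_minus_commute)
  qed simp
  then show ?thesis by (simp add: LIM_zero_iff)
qed

lemma cfc_approx:
  assumes "continuous_on UNIV g" "norm x < R"
  obtains P where "\<And>k t. \<bar>t\<bar> \<le> R \<Longrightarrow> \<bar>g t - poly (P k) t\<bar> \<le> inverse (real (Suc k))"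
    and "\<And>b. (\<lambda>k. X.act (P k) b) \<longlonglongrightarrow> cfc x g b"
proof -
  have "\<exists>p. \<forall>t. \<bar>t\<bar> \<le> R \<longrightarrow> \<bar>g t - poly p t\<bar> \<le> inverse (real (Suc k))" for k
    using ex_poly_approx[OF assms(1), of "inverse (real (Suc k))"] by (metis inverse_positive_iff_positive of_nat_0_less_iff zero_less_Suc)
  then obtain P where P: "\<And>k t. \<bar>t\<bar> \<le> R \<Longrightarrow> \<bar>g t - poly (P k) t\<bar> \<le> inverse (real (Suc k))"
    by metis
  show thesis
    by (rule that[OF P cfc_tendsto[OF assms P LIMSEQ_inverse_real_of_nat]])
qed

text \<open>The supremum runs over an interval around 0 and not over the spectrum. Positivity of an
  element thus has to enter separately, as the vanishing of its negative part.\<close>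

lemma norm_cfc_le:
  assumes g: "continuous_on UNIV g" and R: "norm x < R" and C: "\<And>t. \<bar>t\<bar> \<le> R \<Longrightarrow> \<bar>g t\<bar> \<le> C"
  shows "norm (cfc x g b) \<le> C * norm b"
proof -
  obtain P where P: "\<And>k t. \<bar>t\<bar> \<le> R \<Longrightarrow> \<bar>g t - poly (P k) t\<bar> \<le> inverse (real (Suc k))"
    and lim: "\<And>b. (\<lambda>k. X.act (P k) b) \<longlonglongrightarrow> cfc x g b"
    using cfc_approx[OF g R] by blast
  show ?thesis
  proof (rule LIMSEQ_le)
    show "(\<lambda>k. norm (X.act (P k) b)) \<longlonglongrightarrow> norm (cfc x g b)"
      by (intro tendsto_intros lim)
    have "(\<lambda>k. (C + inverse (real (Suc k))) * norm b) \<longlonglongrightarrow> (C + 0) * norm b"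
      by (intro tendsto_intros LIMSEQ_inverse_real_of_nat)
    then show "(\<lambda>k. (C + inverse (real (Suc k))) * norm b) \<longlonglongrightarrow> C * norm b" by simp
    have "norm (X.act (P k) b) \<le> (C + inverse (real (Suc k))) * norm b" for k
      by (rule norm_poly_act_le[OF star_self R]) (smt (verit) C P)
    then show "\<exists>N. \<forall>k\<ge>N. norm (X.act (P k) b) \<le> (C + inverse (real (Suc k))) * norm b"
      by blast
  qed
qed

lemma cfc_poly: "cfc x (poly p) b = X.act p b"
  using norm_cfc_diff_act_le[of "poly p" "norm x + 1" p 0 b]
  by (simp add: continuous_intros)

lemma cfc_const: "cfc x (\<lambda>t. c) b = c *\<^sub>R b"
proof -
  have "(\<lambda>t :: real. c) = poly [:c:]" by auto
  then show ?thesis by (simp only: cfc_poly) simp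
qed

lemma cfc_id: "cfc x (\<lambda>t. t) b = x * b"
proof -
  have "(\<lambda>t :: real. t) = poly [:0, 1:]" by auto
  then show ?thesis by (simp only: cfc_poly) simp
qed

lemma cfc_diff:
  assumes "continuous_on UNIV g" "continuous_on UNIV h"
  shows "cfc x (\<lambda>t. g t - h t) b = cfc x g b - cfc x h b"
proof -
  have R: "norm x < norm x + 1" by simp
  obtain P where P: "\<And>k t. \<bar>t\<bar> \<le> norm x + 1 \<Longrightarrow> \<bar>g t - poly (P k) t\<bar> \<le> inverse (real (Suc k))"
    and limP: "\<And>b. (\<lambda>k. X.act (P k) b) \<longlonglongrightarrow> cfc x g b"
    using cfc_approx[OF assms(1) R] by blast
  obtain Q where Q: "\<And>k t. \<bar>t\<bar> \<le> norm x + 1 \<Longrightarrow> \<bar>h t - poly (Q k) t\<bar> \<le> inverse (real (Suc k))"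
    and limQ: "\<And>b. (\<lambda>k. X.act (Q k) b) \<longlonglongrightarrow> cfc x h b"
    using cfc_approx[OF assms(2) R] by blast
  have "(\<lambda>k. X.act (P k - Q k) b) \<longlonglongrightarrow> cfc x (\<lambda>t. g t - h t) b"
  proof (rule cfc_tendsto[OF _ R])
    show "(\<lambda>k. inverse (real (Suc k)) + inverse (real (Suc k))) \<longlonglongrightarrow> 0"
      using tendsto_add[OF LIMSEQ_inverse_real_of_nat LIMSEQ_inverse_real_of_nat] by simp
    show "\<bar>g t - h t - poly (P k - Q k) t\<bar> \<le> inverse (real (Suc k)) + inverse (real (Suc k))"
      if "\<bar>t\<bar> \<le> norm x + 1" for k t
      using P[OF that, of k] Q[OF that, of k] by simp
  qed (intro continuous_intros assms)
  moreover have "(\<lambda>k. X.act (P k - Q k) b) \<longlonglongrightarrow> cfc x g b - cfc x h b"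
    unfolding X.act_diff by (intro tendsto_intros limP limQ)
  ultimately show ?thesis by (rule LIMSEQ_unique)
qed

lemma cfc_minus:
  assumes "continuous_on UNIV g"
  shows "cfc x (\<lambda>t. - g t) b = - cfc x g b"
  using cfc_diff[OF continuous_on_const assms, of 0 b] by (simp add: cfc_const)

lemma cfc_add:
  assumes "continuous_on UNIV g" "continuous_on UNIV h"
  shows "cfc x (\<lambda>t. g t + h t) b = cfc x g b + cfc x h b"
  using cfc_diff[OF assms(1) continuous_on_minus[OF assms(2)]] cfc_minus[OF assms(2)] by simp

text \<open>One factor is approximated at a time: first \<open>h\<close> against a fixed polynomial,
  then \<open>g\<close> against the fixed \<open>h\<close>; boundedness of the fixed factor on the
  interval controls the error.\<close>

lemma cfc_mult:
  assumes g: "continuous_on UNIV g" and h: "continuous_on UNIV h"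
  shows "cfc x (\<lambda>t. g t * h t) b = cfc x g (cfc x h b)"
proof -
  let ?R = "norm x + 1"
  have R: "norm x < ?R" by simp
  obtain H where H: "\<And>t. \<bar>t\<bar> \<le> ?R \<Longrightarrow> \<bar>h t\<bar> \<le> H"
    using continuous_bounded_on_interval[OF h] by blast
  have lim: "(\<lambda>k. inverse (real (Suc k)) * c) \<longlonglongrightarrow> 0" for c
    using tendsto_mult_right[OF LIMSEQ_inverse_real_of_nat, of c] by simp
  have poly: "cfc x (\<lambda>t. poly p t * h t) b = X.act p (cfc x h b)" for p
  proof -
    obtain Q where Q: "\<And>k t. \<bar>t\<bar> \<le> ?R \<Longrightarrow> \<bar>h t - poly (Q k) t\<bar> \<le> inverse (real (Suc k))"
      and limQ: "\<And>b. (\<lambda>k. X.act (Q k) b) \<longlonglongrightarrow> cfc x h b"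
      using cfc_approx[OF h R] by blast
    have "continuous_on UNIV (poly p)" by (intro continuous_intros)
    from continuous_bounded_on_interval[OF this]
    obtain K where K: "\<And>t. \<bar>t\<bar> \<le> ?R \<Longrightarrow> \<bar>poly p t\<bar> \<le> K" by blast
    have "(\<lambda>k. X.act (p * Q k) b) \<longlonglongrightarrow> cfc x (\<lambda>t. poly p t * h t) b"
    proof (rule cfc_tendsto[OF _ R _ lim])
      show "\<bar>poly p t * h t - poly (p * Q k) t\<bar> \<le> inverse (real (Suc k)) * K"
        if "\<bar>t\<bar> \<le> ?R" for k t
      proof -
        have "poly p t * h t - poly (p * Q k) t = (h t - poly (Q k) t) * poly p t"
          by (simp add: algebra_simps)
        then show ?thesis
          using mult_mono[OF Q[OF that, of k] K[OF that]] by (simp add: abs_mult)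
      qed
    qed (intro continuous_intros h)
    moreover have "(\<lambda>k. X.act (p * Q k) b) \<longlonglongrightarrow> X.act p (cfc x h b)"
      unfolding X.act_mult by (intro bounded_linear.tendsto[OF bounded_linear_poly_act] limQ)
    ultimately show ?thesis by (rule LIMSEQ_unique)
  qed
  obtain P where P: "\<And>k t. \<bar>t\<bar> \<le> ?R \<Longrightarrow> \<bar>g t - poly (P k) t\<bar> \<le> inverse (real (Suc k))"
    and limP: "\<And>b. (\<lambda>k. X.act (P k) b) \<longlonglongrightarrow> cfc x g b"
    using cfc_approx[OF g R] by blast
  have "(\<lambda>k. X.act (P k) (cfc x h b) - cfc x (\<lambda>t. g t * h t) b) \<longlonglongrightarrow> 0"
  proof (rule tendsto_norm_zero_cancel, rule tendsto_sandwich[OF _ _ tendsto_const])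
    have "norm (cfc x (\<lambda>t. poly (P k) t * h t - g t * h t) b) \<le> inverse (real (Suc k)) * H * norm b" for k
    proof (rule norm_cfc_le[OF _ R])
      show "\<bar>poly (P k) t * h t - g t * h t\<bar> \<le> inverse (real (Suc k)) * H" if "\<bar>t\<bar> \<le> ?R" for t
      proof -
        have "poly (P k) t * h t - g t * h t = (poly (P k) t - g t) * h t"
          by (simp add: algebra_simps)
        then show ?thesis
          using mult_mono[OF P[OF that, of k] H[OF that]]
          by (simp add: abs_mult abs_minus_commute)
      qed
    qed (intro continuous_intros g h)
    then show "eventually (\<lambda>k. norm (X.act (P k) (cfc x h b) - cfc x (\<lambda>t. g t * h t) b)
        \<le> inverse (real (Suc k)) * (H * norm b)) sequentially"
      by (subst (asm) cfc_diff) (auto intro!: continuous_intros g h simp: poly mult.assoc)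
  qed (use lim in \<open>simp_all add: mult.assoc\<close>)
  then have "(\<lambda>k. X.act (P k) (cfc x h b)) \<longlonglongrightarrow> cfc x (\<lambda>t. g t * h t) b"
    by (simp add: LIM_zero_iff)
  then show ?thesis using limP by (rule LIMSEQ_unique)
qed

lemma cfc_mult_id:
  assumes "continuous_on UNIV g"
  shows "cfc x g (x * b) = cfc x (\<lambda>t. g t * t) b" "x * cfc x g b = cfc x (\<lambda>t. t * g t) b"
  using cfc_mult[OF assms continuous_on_id] cfc_mult[OF continuous_on_id assms] by (simp_all add: cfc_id)

lemma cfc_times_right:
  assumes "continuous_on UNIV g"
  shows "cfc x g b * c = cfc x g (b * c)"
proof -
  obtain P where lim: "\<And>b. (\<lambda>k. X.act (P k) b) \<longlonglongrightarrow> cfc x g b"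
    using cfc_approx[OF assms, of "norm x + 1"] less_add_one by metis
  have "X.act p b * c = X.act p (b * c)" for p
    by (induction p) (simp_all add: distrib_right mult.assoc)
  then have "(\<lambda>k. X.act (P k) (b * c)) \<longlonglongrightarrow> cfc x g b * c"
    using tendsto_mult[OF lim[of b] tendsto_const[of c]] by simp
  then show ?thesis using lim by (rule LIMSEQ_unique)
qed

lemma star_cfc:
  assumes "continuous_on UNIV g"
  shows "star (cfc x g b) * c = star b * cfc x g c"
proof -
  obtain P where lim: "\<And>b. (\<lambda>k. X.act (P k) b) \<longlonglongrightarrow> cfc x g b"
    using cfc_approx[OF assms, of "norm x + 1"] less_add_one by metis
  have "(\<lambda>k. star (X.act (P k) b) * c) \<longlonglongrightarrow> star (cfc x g b) * c"
    by (intro tendsto_intros tendsto_star lim)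
  moreover have "(\<lambda>k. star b * X.act (P k) c) \<longlonglongrightarrow> star b * cfc x g c"
    by (intro tendsto_intros lim)
  ultimately show ?thesis
    unfolding star_poly_act[OF star_self] by (rule LIMSEQ_unique)
qed

text \<open>Applied to \<open>x\<close> itself, the operator g(x) yields a genuine element x g(x) of
  the algebra, whose left multiplication is the operator of t g(t).\<close>

lemma star_cfc_self:
  assumes "continuous_on UNIV g"
  shows "star (cfc x g x) = cfc x g x"
proof -
  have "star (cfc x g x) * c = cfc x g x * c" for c
    by (simp add: star_cfc cfc_times_right assms star_self cfc_mult_id mult.commute)
  then have "norm ((star (cfc x g x) - cfc x g x) * c) \<le> 0 * norm c" for c
    by (simp add: left_diff_distrib)
  from norm_le_if_mult_le[OF this] show ?thesis by simp
qed

lemma cfc_mem: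
  assumes "continuous_on UNIV g" and M: "cstar_subalgebra M" "x \<in> M" "b \<in> M"
  shows "cfc x g b \<in> M"
proof -
  obtain P where lim: "\<And>b. (\<lambda>k. X.act (P k) b) \<longlonglongrightarrow> cfc x g b"
    using cfc_approx[OF assms(1), of "norm x + 1"] less_add_one by metis
  have "X.act p b \<in> M" for p
    using M by (induction p) (auto simp: cstar_subalgebra_def scaleR_scaleC)
  then show ?thesis
    using closed_sequentially[OF _ _ lim] M(1) by (auto simp: cstar_subalgebra_def)
qed

end

lemma (in cstar_homomorphism) hom_cfc:
  assumes x: "star x = x" and g: "continuous_on UNIV g"
  shows "\<rho> (cfc x g b) = cfc (\<rho> x) g (\<rho> b)"
proof -
  interpret x: self_adjoint x by unfold_locales (rule x)
  interpret y: self_adjoint "\<rho> x" by unfold_locales (simp add: x flip: hom_star)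
  obtain P where P: "\<And>k t. \<bar>t\<bar> \<le> norm x + 1 \<Longrightarrow> \<bar>g t - poly (P k) t\<bar> \<le> inverse (real (Suc k))"
    and lim: "\<And>b. (\<lambda>k. x.X.act (P k) b) \<longlonglongrightarrow> cfc x g b"
    using x.cfc_approx[OF g, of "norm x + 1"] by auto
  have "(\<lambda>k. \<rho> (x.X.act (P k) b)) \<longlonglongrightarrow> \<rho> (cfc x g b)"
    by (intro hom.tendsto lim)
  moreover have "(\<lambda>k. y.X.act (P k) (\<rho> b)) \<longlonglongrightarrow> cfc (\<rho> x) g (\<rho> b)"
    by (rule y.cfc_tendsto[OF g _ P LIMSEQ_inverse_real_of_nat])
      (use norm_hom_le[of x] in auto)
  ultimately show ?thesis
    unfolding hom_poly_act by (rule LIMSEQ_unique)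
qed

subsection \<open>Injective homomorphisms are isometric\<close>

text \<open>
  Otherwise \<open>\<rho>\<close> shrinks some self-adjoint \<open>x\<close>; a function vanishing on the spectrum of \<open>\<rho> x\<close>
  but not on that of \<open>x\<close> then gives a nonzero element of the kernel.
\<close>

lemma (in cstar_homomorphism) norm_hom_eq:
  assumes M: "cstar_subalgebra M" and inj: "inj_on \<rho> M" and m: "m \<in> M"
  shows "norm (\<rho> m) = norm m"
proof -
  define x where "x = star m * m"
  have x: "star x = x" "x \<in> M"
    using M m by (auto simp: x_def star_simps cstar_subalgebra_def)
  interpret x: self_adjoint x by unfold_locales (rule x)
  interpret y: self_adjoint "\<rho> x" by unfold_locales (simp add: x flip: hom_star)
  have "norm x \<le> norm (\<rho> x)"
  proof (rule ccontr)
    assume "\<not> norm x \<le> norm (\<rho> x)"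
    then obtain r where r: "norm (\<rho> x) < r" "r < norm x" by (meson dense not_le)
    then have r0: "0 < r" using norm_ge_zero le_less_trans by blast
    \<comment> \<open>This function vanishes exactly on [-r, r], and t - h(t) t = r t / max r |t| is
      t cut off at r and -r. Once h(x) x is 0, \<open>x\<close> equals its cut-off and has norm at
      most r.\<close>
    define h where "h t = 1 - r / max r \<bar>t\<bar>" for t
    have "max r \<bar>t\<bar> \<noteq> 0" for t using r0 by linarith
    then have h: "continuous_on UNIV h"
      unfolding h_def by (intro continuous_intros) auto
    have "\<rho> (cfc x h x) = cfc (\<rho> x) h (\<rho> x)"
      by (rule hom_cfc[OF x(1) h])
    also have "norm \<dots> \<le> 0 * norm (\<rho> x)"
      by (rule y.norm_cfc_le[OF h r(1)]) (use r0 in \<open>auto simp: h_def max_def\<close>)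
    finally have "\<rho> (cfc x h x) = \<rho> 0" by (simp add: hom.zero)
    then have zero: "cfc x h x = 0"
      using inj x.cfc_mem[OF h M x(2) x(2)] M
      by (metis cstar_subalgebra_def inj_onD)
    have "norm (x * b) \<le> r * norm b" for b
    proof -
      have "cfc x (\<lambda>t. h t * t) b = 0"
        by (simp add: x.cfc_mult_id(1)[symmetric] h x.cfc_times_right[symmetric] zero)
      then have "x * b = cfc x (\<lambda>t. t - h t * t) b"
        by (subst x.cfc_diff) (auto intro!: continuous_intros h simp: x.cfc_id)
      also have "norm \<dots> \<le> r * norm b"
      proof (rule x.norm_cfc_le[OF _ less_add_one])
        fix t :: real
        have "t - h t * t = r * (t / max r \<bar>t\<bar>)" by (simp add: h_def algebra_simps)
        moreover have "\<bar>t / max r \<bar>t\<bar>\<bar> \<le> 1" using r0 by (simp add: abs_divide divide_le_eq)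
        ultimately show "\<bar>t - h t * t\<bar> \<le> r"
          using r0 mult_left_mono[of "\<bar>t / max r \<bar>t\<bar>\<bar>" 1 r] by (simp only: abs_mult) simp
      qed (intro continuous_intros h)
      finally show ?thesis .
    qed
    then have "norm x \<le> r" by (rule norm_le_if_mult_le) (use r0 in simp)
    with r show False by simp
  qed
  then have "(norm m)\<^sup>2 \<le> (norm (\<rho> m))\<^sup>2"
    by (simp add: x_def hom_mult hom_star cstar_identity)
  then have "norm m \<le> norm (\<rho> m)" by (rule power2_le_imp_le) simp
  with norm_hom_le[of m] show ?thesis by simp
qed

subsection \<open>Positivity of \<open>c\<^sup>* c\<close>\<close>

text \<open>A norm form of x^2 \<ge> 0: with R = \<open>norm x + 1\<close>, the polynomial R^2 - t^2
  lies between 0 and R^2 for |t| \<le> R.\<close>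

lemma norm_diff_square_le:
  fixes x :: "'a::cstar_algebra"
  assumes "star x = x"
  shows "norm ((norm x + 1)\<^sup>2 *\<^sub>R b - x * x * b) \<le> (norm x + 1)\<^sup>2 * norm b"
proof -
  have "norm (poly_act scaleR ((*) x) [:(norm x + 1)\<^sup>2, 0, -1:] b) \<le> (norm x + 1)\<^sup>2 * norm b"
  proof (rule norm_poly_act_le[OF assms less_add_one])
    show "\<bar>poly [:(norm x + 1)\<^sup>2, 0, - 1:] t\<bar> \<le> (norm x + 1)\<^sup>2" if "\<bar>t\<bar> \<le> norm x + 1" for t
    proof -
      have "t\<^sup>2 \<le> (norm x + 1)\<^sup>2" using power_mono[OF that, of 2] by simp
      then show ?thesis by (simp add: abs_le_iff power2_eq_square)
    qed
  qed
  moreover interpret module_endo scaleR "(*) x" by (rule module_endo_times)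
  have "act [:(norm x + 1)\<^sup>2, 0, -1:] b = (norm x + 1)\<^sup>2 *\<^sub>R b - x * x * b"
    by (simp add: mult.assoc)
  ultimately show ?thesis by simp
qed

lemma (in self_adjoint) cfc_eq_0_if_square:
  assumes g: "continuous_on UNIV g" and sq: "\<And>b. cfc x (\<lambda>t. g t * g t) b = 0"
  shows "cfc x g b = 0"
proof -
  have "star (cfc x g b) * cfc x g b = 0"
    using sq[of b] by (simp add: star_cfc g cfc_mult)
  then have "(norm (cfc x g b))\<^sup>2 = 0" by (simp flip: cstar_identity)
  then show ?thesis by simp
qed

text \<open>On the right the squares of \<open>z\<close> and \<open>star z\<close> cancel and only
  the mixed products remain; both elements squared there are self-adjoint.\<close>

lemma mult_star_swap:
  fixes z :: "'a::cstar_algebra"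
  shows "z * star z + star z * z
    = (1/2) *\<^sub>R ((z + star z) * (z + star z) + (\<i> *\<^sub>C (z - star z)) * (\<i> *\<^sub>C (z - star z)))"
proof -
  have "(\<i> *\<^sub>C (z - star z)) * (\<i> *\<^sub>C (z - star z)) = - ((z - star z) * (z - star z))"
    by (simp add: mult_scaleC_left mult_scaleC_right scaleC_scaleC)
  then have "(z + star z) * (z + star z) + (\<i> *\<^sub>C (z - star z)) * (\<i> *\<^sub>C (z - star z))
      = (2::real) *\<^sub>R (z * star z + star z * z)"
    by (simp add: algebra_simps scaleR_2)
  then show ?thesis by simp
qed

text \<open>
  If \<open>z\<^sup>* z = -g(a)\<close> with \<open>g \<ge> 0\<close>, then also \<open>z z\<^sup>* \<ge> 0\<close>, as \<open>z\<^sup>* z + z z\<^sup>*\<close> is a sum of squares.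
  Hence \<open>1 - z z\<^sup>*/T\<close> is a contraction for large \<open>T\<close>. The identity
  \<open>z = (1 - z z\<^sup>*/T)\<^sup>n z (1 + g(a)/T)\<^sup>-\<^sup>n\<close> then yields \<open>z = 0\<close> for \<open>n \<rightarrow> \<infinity>\<close>.
\<close>

lemma (in self_adjoint) eq_0_if_square_nonpos:
  fixes z :: 'a
  assumes g: "continuous_on UNIV g" "\<And>t. 0 \<le> g t"
    and z: "\<And>b. star z * z * b = - cfc x g b"
  shows "z = 0"
proof -
  let ?R = "norm x + 1"
  define p where "p = z + star z"
  define q where "q = \<i> *\<^sub>C (z - star z)"
  have p: "star p = p" and q: "star q = q"
    by (simp_all add: p_def q_def star_simps add.commute scaleC.scale_right_diff_distrib)
  obtain T0 where T0: "\<And>t. \<bar>t\<bar> \<le> ?R \<Longrightarrow> \<bar>g t\<bar> \<le> T0"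
    using continuous_bounded_on_interval[OF g(1)] by blast
  \<comment> \<open>One summand for each term of z \<open>star z\<close> = p^2 / 2 + q^2 / 2 + g(x);
    \<open>contr\<close> adds up the three separate estimates.\<close>
  define T where "T = (1/2) * (norm p + 1)\<^sup>2 + (1/2) * (norm q + 1)\<^sup>2 + T0"
  have "0 \<le> T0" using T0[of 0] by (auto intro: order_trans[OF abs_ge_zero])
  moreover have "0 < norm p + 1" by (simp add: add_nonneg_pos)
  ultimately have T: "0 < T" by (simp add: T_def add_pos_nonneg)
  have contr: "norm (T *\<^sub>R b - z * star z * b) \<le> T * norm b" for b
  proof -
    have "norm (cfc x (\<lambda>t. T0 - g t) b) \<le> T0 * norm b"
      by (rule norm_cfc_le[OF _ less_add_one])
        (use T0 g in \<open>auto intro!: continuous_intros simp: abs_le_iff\<close>)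
    then have "norm (T0 *\<^sub>R b - cfc x g b) \<le> T0 * norm b"
      by (subst (asm) cfc_diff) (auto intro!: g simp: cfc_const)
    moreover have "z * star z * b = (1/2) *\<^sub>R (p * p * b) + (1/2) *\<^sub>R (q * q * b) + cfc x g b"
      using arg_cong[OF mult_star_swap[of z], of "\<lambda>v. v * b"] z[of b]
      by (simp add: p_def[symmetric] q_def[symmetric] distrib_right scaleR_add_right diff_eq_eq)
    then have "T *\<^sub>R b - z * star z * b = (1/2) *\<^sub>R ((norm p + 1)\<^sup>2 *\<^sub>R b - p * p * b)
        + (1/2) *\<^sub>R ((norm q + 1)\<^sup>2 *\<^sub>R b - q * q * b) + (T0 *\<^sub>R b - cfc x g b)"
      by (simp add: T_def scaleR_left_distrib scaleR_right_diff_distrib)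
    moreover have "norm (\<dots>) \<le> norm ((1/2) *\<^sub>R ((norm p + 1)\<^sup>2 *\<^sub>R b - p * p * b))
        + norm ((1/2) *\<^sub>R ((norm q + 1)\<^sup>2 *\<^sub>R b - q * q * b)) + norm (T0 *\<^sub>R b - cfc x g b)"
      by (intro order_trans[OF norm_triangle_ineq] add_right_mono norm_triangle_ineq)
    moreover note norm_diff_square_le[OF p, of b] norm_diff_square_le[OF q, of b]
    ultimately show ?thesis by (simp add: T_def distrib_right)
  qed
  define G where "G t = 1 / (1 + g t / T)" for t
  have pos: "0 < 1 + g t / T" for t using g(2)[of t] T by (simp add: add_pos_nonneg)
  have G: "continuous_on UNIV (\<lambda>t. G t ^ n)" for n
    unfolding G_def by (intro continuous_intros g) (use T pos less_imp_neq in metis)+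
  \<comment> \<open>From T G^n = (T + g) G^(n+1); the factor g(x) passes to the left of
    \<open>z\<close> as - z \<open>star z\<close>.\<close>
  have step: "T *\<^sub>R (z * cfc x (\<lambda>t. G t ^ n) w)
      = T *\<^sub>R (z * cfc x (\<lambda>t. G t ^ Suc n) w) - z * star z * (z * cfc x (\<lambda>t. G t ^ Suc n) w)" for n w
  proof -
    have "T * G t ^ n = T * G t ^ Suc n + g t * G t ^ Suc n" for t
    proof -
      have "0 < T + g t" using T g(2)[of t] by simp
      then have "G t * (T + g t) = T" using T by (simp add: G_def field_simps)
      then have "T * G t ^ n = G t * (T + g t) * G t ^ n" by (simp only:)
      then show ?thesis by (simp add: algebra_simps)
    qed
    then have "cfc x (\<lambda>t. T * G t ^ n) w = cfc x (\<lambda>t. T * G t ^ Suc n + g t * G t ^ Suc n) w"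
      by simp
    then have "T *\<^sub>R cfc x (\<lambda>t. G t ^ n) w
        = T *\<^sub>R cfc x (\<lambda>t. G t ^ Suc n) w + cfc x g (cfc x (\<lambda>t. G t ^ Suc n) w)"
      by (simp only: cfc_add cfc_mult G g cfc_const continuous_on_const continuous_on_mult)
    then have "z * (T *\<^sub>R cfc x (\<lambda>t. G t ^ n) w) = z * (T *\<^sub>R cfc x (\<lambda>t. G t ^ Suc n) w
        + cfc x g (cfc x (\<lambda>t. G t ^ Suc n) w))" by simp
    moreover have "z * cfc x g v = - (z * star z * (z * v))" for v
      using arg_cong[OF z[of v], of "\<lambda>u. z * u"] by (simp add: mult.assoc)
    ultimately show ?thesis by (simp add: distrib_left)
  qed
  have le: "norm (z * w) \<le> norm (z * cfc x (\<lambda>t. G t ^ n) w)" for n w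
  proof (induction n)
    case (Suc n)
    have "T * norm (z * cfc x (\<lambda>t. G t ^ n) w) \<le> T * norm (z * cfc x (\<lambda>t. G t ^ Suc n) w)"
      using contr[of "z * cfc x (\<lambda>t. G t ^ Suc n) w"] T
      by (simp only: step[symmetric] norm_scaleR abs_of_pos)
    then have "norm (z * cfc x (\<lambda>t. G t ^ n) w) \<le> norm (z * cfc x (\<lambda>t. G t ^ Suc n) w)"
      using T by simp
    with Suc show ?case by simp
  qed (simp add: cfc_const)
  \<comment> \<open>Up to sign, the square of z G^n w is \<open>star w\<close> g G^(2n) w, and
    Bernoulli's inequality n g / T \<le> (1 + g / T)^n gives g G^n \<le> T / n.\<close>
  have bound: "(norm (z * w))\<^sup>2 \<le> T / n * (norm w)\<^sup>2" if "0 < n" for n :: nat and w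
  proof -
    let ?v = "cfc x (\<lambda>t. G t ^ n) w"
    have "star (z * ?v) * (z * ?v) = - (star w * cfc x (\<lambda>t. G t ^ n * (g t * G t ^ n)) w)"
      using arg_cong[OF z[of ?v], of "\<lambda>u. star ?v * u"]
      by (simp add: star_mult mult.assoc star_cfc cfc_times_right G g cfc_mult continuous_on_mult)
    then have "(norm (z * ?v))\<^sup>2 = norm (star w * cfc x (\<lambda>t. G t ^ n * (g t * G t ^ n)) w)"
      by (simp flip: cstar_identity)
    also have "\<dots> \<le> norm w * norm (cfc x (\<lambda>t. G t ^ n * (g t * G t ^ n)) w)"
      using norm_mult_ineq[of "star w"] by simp
    also have "\<dots> \<le> norm w * (T / n * norm w)"
    proof (intro mult_left_mono norm_cfc_le[OF _ less_add_one])
      fix t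
      have G1: "0 \<le> G t ^ k" "G t ^ k \<le> 1" for k
      proof -
        have "0 \<le> g t / T" using g(2)[of t] T by simp
        then have "0 \<le> G t" "G t \<le> 1" by (simp_all add: G_def divide_le_eq_1)
        then show "0 \<le> G t ^ k" "G t ^ k \<le> 1" by (simp_all add: power_le_one)
      qed
      have "-1 \<le> g t / T" using pos[of t] by linarith
      from Bernoulli_inequality[OF this, of n]
      have "n * (g t / T) \<le> (1 + g t / T) ^ n" by linarith
      then have "n * (g t / T) * G t ^ n \<le> (1 + g t / T) ^ n * G t ^ n"
        using G1 by (intro mult_right_mono)
      also have "\<dots> = 1" using pos[of t] by (simp add: G_def flip: power_mult_distrib)
      finally have "g t * G t ^ n \<le> T / n" using that T by (simp add: field_simps)
      then have "G t ^ n * (g t * G t ^ n) \<le> 1 * (T / n)"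
        using G1[of n] g(2)[of t] by (intro mult_mono) auto
      then show "\<bar>G t ^ n * (g t * G t ^ n)\<bar> \<le> T / n"
        using G1[of n] g(2)[of t] by simp
    qed (auto intro!: continuous_intros G g)
    finally have "(norm (z * ?v))\<^sup>2 \<le> T / n * (norm w)\<^sup>2"
      by (simp add: power2_eq_square algebra_simps)
    moreover have "(norm (z * w))\<^sup>2 \<le> (norm (z * ?v))\<^sup>2"
      by (intro power_mono le) simp
    ultimately show ?thesis by linarith
  qed
  have "norm (z * w) \<le> 0 * norm w" for w
  proof -
    have "(\<lambda>n. T / real n * (norm w)\<^sup>2) \<longlonglongrightarrow> 0"
      by real_asymp
    moreover have "\<forall>n\<ge>1. (norm (z * w))\<^sup>2 \<le> T / real n * (norm w)\<^sup>2"
      using bound by auto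
    ultimately have "(norm (z * w))\<^sup>2 \<le> 0" by (rule LIMSEQ_le_const[OF _ exI])
    then show ?thesis by simp
  qed
  then have "norm z \<le> 0" by (rule norm_le_if_mult_le) simp
  then show ?thesis by simp
qed

text \<open>With n the negative part and e = a n(a) = - n(a)^2 one gets
  \<open>star (c * e) * (c * e)\<close> = e a e = - n(a)^5. So c e = 0 by the preceding result, and
  n(a) = 0.\<close>

theorem norm_diff_star_mult_self_le:
  fixes c :: "'a::cstar_algebra"
  assumes T: "norm (star c * c) < T"
  shows "norm (T *\<^sub>R b - star c * c * b) \<le> T * norm b"
proof -
  define a where "a = star c * c"
  interpret a: self_adjoint a by unfold_locales (simp add: a_def star_simps)
  define n where "n t = max (- t) 0" for t :: real
  have n: "continuous_on UNIV n" "\<And>t. 0 \<le> n t"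
    unfolding n_def by (auto intro!: continuous_intros)
  have pow: "continuous_on UNIV (\<lambda>t. n t ^ k)" for k by (intro continuous_intros n)
  have tn: "t * n t = - (n t ^ 2)" for t by (simp add: n_def max_def power2_eq_square)
  define e where "e = cfc a n a"
  have e: "e * b = - cfc a (\<lambda>t. n t ^ 2) b" for b
    using a.cfc_minus[OF pow, of 2]
    by (simp add: e_def a.cfc_times_right n a.cfc_mult_id mult.commute[of "n _"] tn)
  have "star (c * e) * (c * e) * b = - cfc a (\<lambda>t. n t ^ 5) b" for b
  proof -
    have "star (c * e) * (c * e) * b = e * (a * (e * b))"
      using a.star_cfc_self[OF n(1)] by (simp add: star_mult a_def mult.assoc e_def)
    also have "\<dots> = cfc a (\<lambda>t. n t ^ 2 * (t * n t ^ 2)) b"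
      by (simp add: e a.cfc_mult pow a.cfc_mult_id continuous_on_mult)
    also have "(\<lambda>t. n t ^ 2 * (t * n t ^ 2)) = (\<lambda>t. - (n t ^ 5))"
      by (auto simp: n_def max_def power2_eq_square eval_nat_numeral)
    finally show ?thesis by (simp add: a.cfc_minus pow)
  qed
  then have "c * e = 0"
    by (rule a.eq_0_if_square_nonpos[OF pow, rotated]) (simp add: n)
  then have "cfc a (\<lambda>t. n t ^ 5) b = 0" for b
    using \<open>\<And>b. star (c * e) * (c * e) * b = _\<close>[of b] by simp
  \<comment> \<open>The exponent is raised from 5 to 8, a power of 2, so that taking square roots
    leads down to n.\<close>
  then have "cfc a (\<lambda>t. n t ^ 3 * n t ^ 5) b = 0" for b
    using a.cfc_mult[OF pow[of 3] pow[of 5], of b] a.cfc_times_right[OF pow[of 3], of 0 0] by simp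
  then have 8: "cfc a (\<lambda>t. n t ^ 8) b = 0" for b by (simp flip: power_add)
  have 4: "cfc a (\<lambda>t. n t ^ 4) b = 0" for b
    by (rule a.cfc_eq_0_if_square[OF pow]) (simp add: 8 flip: power_add)
  have 2: "cfc a (\<lambda>t. n t ^ 2) b = 0" for b
    by (rule a.cfc_eq_0_if_square[OF pow]) (simp add: 4 flip: power_add)
  have 1: "cfc a n b = 0"
    by (rule a.cfc_eq_0_if_square[OF n(1)]) (simp add: 2 flip: power2_eq_square)
  \<comment> \<open>For |t| \<le> T the function T - max t 0 takes values in [0, T], and n(a) = 0
    makes it represent T - a.\<close>
  have "norm (cfc a (\<lambda>t. (T - t) - n t) b) \<le> T * norm b"
  proof (rule a.norm_cfc_le[OF _ T[folded a_def]])
    show "continuous_on UNIV (\<lambda>t. (T - t) - n t)" by (intro continuous_intros n)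
  qed (auto simp: n_def)
  moreover have "cfc a (\<lambda>t. (T - t) - n t) b = T *\<^sub>R b - a * b"
    by (subst a.cfc_diff)
      (auto intro!: continuous_intros n simp: 1 a.cfc_diff a.cfc_const a.cfc_id)
  ultimately show ?thesis by (simp add: a_def)
qed

subsection \<open>The Hahn-Banach theorem\<close>

definition sublinear :: "('v::real_vector \<Rightarrow> real) \<Rightarrow> bool" where
  "sublinear q \<longleftrightarrow> (\<forall>x y. q (x + y) \<le> q x + q y) \<and> (\<forall>r x. 0 \<le> r \<longrightarrow> q (r *\<^sub>R x) = r * q x)"

lemma sublinearD:
  assumes "sublinear q"
  shows "q (x + y) \<le> q x + q y" "0 \<le> r \<Longrightarrow> q (r *\<^sub>R x) = r * q x" "q 0 = 0" "- q (- x) \<le> q x"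
proof -
  show 1: "q (x + y) \<le> q x + q y" for x y using assms by (simp add: sublinear_def)
  show 2: "0 \<le> r \<Longrightarrow> q (r *\<^sub>R x) = r * q x" for r x using assms by (simp add: sublinear_def)
  show 3: "q 0 = 0" using 2[of 0 0] by simp
  show "- q (- x) \<le> q x" using 1[of x "- x"] 3 by simp
qed

text \<open>The functional is the infimum of q (x + c) - g c over c in the cone. It serves
  Hahn-Banach twice: with a subspace as cone it builds in the given functional, with a half-line it
  tests minimality.\<close>

lemma sublinear_below_cone:
  fixes q :: "'v::real_vector \<Rightarrow> real"
  assumes q: "sublinear q"
    and C: "0 \<in> C" "\<And>c d. c \<in> C \<Longrightarrow> d \<in> C \<Longrightarrow> c + d \<in> C" "\<And>r c. 0 \<le> r \<Longrightarrow> c \<in> C \<Longrightarrow> r *\<^sub>R c \<in> C"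
    and g: "\<And>c d. c \<in> C \<Longrightarrow> d \<in> C \<Longrightarrow> g (c + d) = g c + g d"
      "\<And>r c. 0 \<le> r \<Longrightarrow> c \<in> C \<Longrightarrow> g (r *\<^sub>R c) = r * g c"
    and le: "\<And>c. c \<in> C \<Longrightarrow> g c \<le> q c"
  shows "\<exists>q'. sublinear q' \<and> (\<forall>x. q' x \<le> q x) \<and> (\<forall>c\<in>C. q' (- c) \<le> - g c)"
proof -
  define q' where "q' x = (INF c\<in>C. q (x + c) - g c)" for x
  have bdd: "bdd_below ((\<lambda>c. q (x + c) - g c) ` C)" for x
  proof (rule bdd_belowI2)
    fix c assume "c \<in> C"
    then show "- q (- x) \<le> q (x + c) - g c"
      using sublinearD(1)[OF q, of "x + c" "- x"] le by fastforce
  qed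
  have lower: "q' x \<le> q (x + c) - g c" if "c \<in> C" for x c
    unfolding q'_def by (rule cINF_lower[OF bdd that])
  have greatest: "z \<le> q' x" if "\<And>c. c \<in> C \<Longrightarrow> z \<le> q (x + c) - g c" for x z
    unfolding q'_def by (rule cINF_greatest) (use C that in auto)
  have g0: "g 0 = 0" using g(2)[of 0 0] C(1) by simp
  have add: "q' (x + y) \<le> q' x + q' y" for x y
  proof -
    have "q' (x + y) - (q (y + d) - g d) \<le> q' x" if d: "d \<in> C" for d
    proof (rule greatest)
      fix c assume c: "c \<in> C"
      have "q' (x + y) \<le> q ((x + y) + (c + d)) - g (c + d)" by (rule lower) (use C c d in auto)
      also have "(x + y) + (c + d) = (x + c) + (y + d)" by simp
      also have "q \<dots> - g (c + d) \<le> q (x + c) + q (y + d) - (g c + g d)"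
        using sublinearD(1)[OF q, of "x + c" "y + d"] g(1)[OF c d] by simp
      finally show "q' (x + y) - (q (y + d) - g d) \<le> q (x + c) - g c" by simp
    qed
    then have "q' (x + y) - q' x \<le> q' y" by (intro greatest) (simp add: algebra_simps)
    then show ?thesis by simp
  qed
  have scale_le: "q' (r *\<^sub>R x) \<le> r * q' x" if r: "0 < r" for r x
  proof -
    have "q' (r *\<^sub>R x) / r \<le> q' x"
    proof (rule greatest)
      fix c assume c: "c \<in> C"
      have "q' (r *\<^sub>R x) \<le> q (r *\<^sub>R x + r *\<^sub>R c) - g (r *\<^sub>R c)" by (rule lower) (use C c r in auto)
      also have "\<dots> = r * (q (x + c) - g c)"
        using r c sublinearD(2)[OF q, of r "x + c"] by (simp add: g scaleR_add_right algebra_simps)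
      finally show "q' (r *\<^sub>R x) / r \<le> q (x + c) - g c"
        using r by (simp add: divide_le_eq mult.commute)
    qed
    then show ?thesis using r by (simp add: divide_le_eq mult.commute)
  qed
  have "q' 0 = 0"
    using lower[OF C(1), of 0] greatest[of 0 0] le by (intro antisym) (auto simp: g0 sublinearD(3)[OF q])
  moreover have "q' (r *\<^sub>R x) = r * q' x" if r: "0 < r" for r x
    using scale_le[OF r, of x] scale_le[of "1 / r" "r *\<^sub>R x"] r by (simp add: field_simps)
  ultimately have "sublinear q'"
    unfolding sublinear_def using add by (metis le_less mult_zero_left scaleR_zero_left)
  moreover have "q' x \<le> q x" for x using lower[OF C(1), of x] by (simp add: g0)
  moreover have "q' (- c) \<le> - g c" if "c \<in> C" for c
    using lower[OF that, of "- c"] by (simp add: sublinearD(3)[OF q])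
  ultimately show ?thesis by blast
qed

lemma ex_minimal_sublinear:
  fixes p :: "'v::real_vector \<Rightarrow> real"
  assumes p: "sublinear p"
  shows "\<exists>m. sublinear m \<and> (\<forall>x. m x \<le> p x)
      \<and> (\<forall>q. sublinear q \<longrightarrow> (\<forall>x. q x \<le> m x) \<longrightarrow> q = m)"
proof -
  define A where "A = {q. sublinear q \<and> (\<forall>x. q x \<le> p x)}"
  \<comment> \<open>The order is reversed, so that the maximal element of Zorn's lemma is a minimal
    functional.\<close>
  define P where "P q r \<longleftrightarrow> (\<forall>x. r x \<le> q x)" for q r :: "'v \<Rightarrow> real"
  have "\<exists>m\<in>A. \<forall>a\<in>A. P m a \<longrightarrow> a = m"
  proof (rule predicate_Zorn)
    show "partial_order_on A (relation_of P A)"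
    proof (rule partial_order_on_relation_ofI)
      show "P a c" if "P a b" "P b c" for a b c using that unfolding P_def by (meson order_trans)
      show "a = b" if "P a b" "P b a" for a b using that unfolding P_def by (auto intro: antisym)
    qed (simp add: P_def)
  next
    fix C assume C: "C \<in> Chains (relation_of P A)"
    then have CA: "q \<in> A" if "q \<in> C" for q
      using that by (auto simp: Chains_def relation_of_def)
    have chain: "P q r \<or> P r q" if "q \<in> C" "r \<in> C" for q r
      using C that by (auto simp: Chains_def relation_of_def)
    show "\<exists>u\<in>A. \<forall>a\<in>C. P a u"
    proof (cases "C = {}")
      case True
      then show ?thesis using p by (auto simp: A_def)
    next
      case False
      define u where "u x = (INF q\<in>C. q x)" for x
      have subl: "sublinear q" if "q \<in> C" for q using CA[OF that] by (simp add: A_def)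
      have bdd: "bdd_below ((\<lambda>q. q x) ` C)" for x
      proof (rule bdd_belowI2)
        fix q assume q: "q \<in> C"
        have "- p (- x) \<le> - q (- x)" using CA[OF q] by (simp add: A_def)
        also have "\<dots> \<le> q x" by (rule sublinearD(4)[OF subl[OF q]])
        finally show "- p (- x) \<le> q x" .
      qed
      have lower: "u x \<le> q x" if "q \<in> C" for x q
        unfolding u_def by (rule cINF_lower[OF bdd that])
      have greatest: "z \<le> u x" if "\<And>q. q \<in> C \<Longrightarrow> z \<le> q x" for x z
        unfolding u_def by (rule cINF_greatest[OF False that])
      have "u (x + y) \<le> u x + u y" for x y
      proof -
        \<comment> \<open>In a chain the smaller of \<open>q\<close> and \<open>r\<close> can be
          used at both x and y.\<close>
        have "u (x + y) \<le> q x + r y" if q: "q \<in> C" and r: "r \<in> C" for q r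
          using chain[OF q r]
        proof
          assume "P q r"
          then show ?thesis
            using lower[OF r, of "x + y"] sublinearD(1)[OF subl[OF r], of x y]
            unfolding P_def by (smt (verit))
        next
          assume "P r q"
          then show ?thesis
            using lower[OF q, of "x + y"] sublinearD(1)[OF subl[OF q], of x y]
            unfolding P_def by (smt (verit))
        qed
        then have "u (x + y) - r y \<le> u x" if "r \<in> C" for r
          using that by (intro greatest) (simp add: algebra_simps)
        then have "u (x + y) - u x \<le> u y"
          by (intro greatest) (simp add: algebra_simps)
        then show ?thesis by simp
      qed
      moreover have "u (r *\<^sub>R x) = r * u x" if r: "0 \<le> r" for r x
      proof (cases "r = 0")
        case True
        have "u 0 = (INF q\<in>C. 0)"
          unfolding u_def by (rule INF_cong) (auto simp: sublinearD(3)[OF subl])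
        with True False show ?thesis by simp
      next
        case False
        then have "0 < r" using r by simp
        have "u (r *\<^sub>R x) / r \<le> u x"
          by (rule greatest)
            (use lower[of _ "r *\<^sub>R x"] sublinearD(2)[OF subl r] \<open>0 < r\<close> in \<open>simp add: divide_le_eq mult.commute\<close>)
        moreover have "r * u x \<le> u (r *\<^sub>R x)"
        proof (rule greatest)
          fix q assume q: "q \<in> C"
          show "r * u x \<le> q (r *\<^sub>R x)"
            using mult_left_mono[OF lower[OF q] r] by (simp add: sublinearD(2)[OF subl[OF q] r])
        qed
        ultimately show ?thesis using \<open>0 < r\<close> by (simp add: divide_le_eq mult.commute)
      qed
      ultimately have "sublinear u" by (simp add: sublinear_def)
      moreover have "u x \<le> p x" for x
        using False lower CA unfolding A_def by (metis (mono_tags, lifting) ex_in_conv mem_Collect_eq order_trans)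
      ultimately show ?thesis using lower by (auto simp: A_def P_def)
    qed
  qed
  then obtain m where m: "m \<in> A" "\<And>a. a \<in> A \<Longrightarrow> P m a \<Longrightarrow> a = m" by blast
  have "q = m" if "sublinear q" "\<And>x. q x \<le> m x" for q
  proof (rule m(2))
    show "q \<in> A" using that m(1) unfolding A_def by (blast intro: order_trans)
  qed (simp add: P_def that)
  with m(1) show ?thesis unfolding A_def by blast
qed

text \<open>A minimal sublinear functional is odd and hence linear. Starting below a functional with
  value at most - f x at - x for x in \<open>W\<close> forces agreement with \<open>f\<close> there,
  since both x and - x lie in \<open>W\<close>.\<close>

theorem Hahn_Banach:
  fixes p :: "'v::real_vector \<Rightarrow> real"
  assumes p: "sublinear p" and W: "subspace W"
    and f: "\<And>x y. x \<in> W \<Longrightarrow> y \<in> W \<Longrightarrow> f (x + y) = f x + f y"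
      "\<And>r x. x \<in> W \<Longrightarrow> f (r *\<^sub>R x) = r * f x"
    and le: "\<And>x. x \<in> W \<Longrightarrow> f x \<le> p x"
  shows "\<exists>F. linear F \<and> (\<forall>x\<in>W. F x = f x) \<and> (\<forall>x. F x \<le> p x)"
proof -
  obtain p0 where p0: "sublinear p0" "\<And>x. p0 x \<le> p x" "\<And>x. x \<in> W \<Longrightarrow> p0 (- x) \<le> - f x"
    using sublinear_below_cone[OF p, of W f] W f le
    by (auto simp: subspace_0 subspace_add subspace_scale)
  obtain m where m: "sublinear m" "\<And>x. m x \<le> p0 x"
    and min: "\<And>q. sublinear q \<Longrightarrow> (\<And>x. q x \<le> m x) \<Longrightarrow> q = m"
    using ex_minimal_sublinear[OF p0(1)] by blast
  have neg: "m (- y) = - m y" for y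
  proof -
    \<comment> \<open>Lowering \<open>m\<close> along the half-line through y cannot change it, by
      minimality; this yields m (- y) \<le> - m y.\<close>
    let ?C = "{t *\<^sub>R y | t. 0 \<le> t}"
    have "\<exists>q. sublinear q \<and> (\<forall>x. q x \<le> m x) \<and> (\<forall>c\<in>?C. q (- c) \<le> - m c)"
    proof (rule sublinear_below_cone[OF m(1)])
      show "0 \<in> ?C" by (auto intro: exI[of _ 0])
      show "c + d \<in> ?C" "m (c + d) = m c + m d" if cd: "c \<in> ?C" "d \<in> ?C" for c d
      proof -
        from cd obtain s t where st: "c = s *\<^sub>R y" "d = t *\<^sub>R y" "0 \<le> s" "0 \<le> t" by auto
        then have cd: "c + d = (s + t) *\<^sub>R y" by (simp add: scaleR_left_distrib)
        with st show "c + d \<in> ?C" by (auto intro!: exI[of _ "s + t"])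
        have "m (c + d) = (s + t) * m y" unfolding cd by (rule sublinearD(2)[OF m(1)]) (use st in simp)
        with st show "m (c + d) = m c + m d" by (simp add: sublinearD(2)[OF m(1)] algebra_simps)
      qed
      show "r *\<^sub>R c \<in> ?C" if "0 \<le> r" "c \<in> ?C" for r c
        using that by (force intro: mult_nonneg_nonneg)
    qed (auto simp: sublinearD(2)[OF m(1)])
    then obtain q where "sublinear q" "\<And>x. q x \<le> m x" "\<And>c. c \<in> ?C \<Longrightarrow> q (- c) \<le> - m c" by blast
    moreover from this have "q = m" by (intro min)
    moreover have "y \<in> ?C" by (auto intro: exI[of _ 1])
    ultimately have "m (- y) \<le> - m y" by blast
    with sublinearD(4)[OF m(1), of y] show ?thesis by simp
  qed
  have "m (x + y) = m x + m y" for x y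
    using sublinearD(1)[OF m(1), of x y] sublinearD(1)[OF m(1), of "x + y" "- y"] by (simp add: neg)
  moreover have "m (r *\<^sub>R x) = r * m x" for r x
    using sublinearD(2)[OF m(1), of r x] sublinearD(2)[OF m(1), of "- r" x] neg[of "r *\<^sub>R x"]
    by (cases "0 \<le> r") auto
  ultimately have "linear m" by (intro linearI) simp_all
  moreover have "m x = f x" if "x \<in> W" for x
  proof -
    have "m x \<ge> f x" using m(2)[of "- x"] p0(3)[OF that] neg[of x] by simp
    moreover have "f (- x) = - f x" using f(2)[OF that, of "-1"] by simp
    then have "m x \<le> f x"
      using m(2)[of x] p0(3)[of "- x"] that W by (simp add: subspace_neg)
    ultimately show ?thesis by simp
  qed
  moreover have "m x \<le> p x" for x using m(2)[of x] p0(2)[of x] by simp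
  ultimately show ?thesis by blast
qed

subsection \<open>States\<close>

lemma tendsto_if_norm_diff_tendsto_0:
  fixes l :: "'b::real_normed_vector"
  assumes "((\<lambda>n. norm (l - X n)) \<longlongrightarrow> 0) F"
  shows "(X \<longlongrightarrow> l) F"
  using assms by (subst tendsto_dist_iff) (simp add: dist_norm norm_minus_commute)

text \<open>The decisive z is - cnj B / A, or a large negative multiple of \<open>cnj B\<close> when
  \<open>A\<close> is 0. It serves both Cauchy-Schwarz and its variant with an adjoined
  unit.\<close>

lemma discriminant_le:
  fixes B :: complex and A D :: real
  assumes "\<And>z. 0 \<le> A * (cmod z)\<^sup>2 + 2 * Re (z * B) + D" and "0 \<le> A"
  shows "(cmod B)\<^sup>2 \<le> A * D"
proof (cases "A = 0")
  case True
  have t: "2 * t * (cmod B)\<^sup>2 \<le> D" for t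
  proof -
    have "Re (- of_real t * cnj B * B) = - t * (cmod B)\<^sup>2"
      unfolding cmod_power2 by (simp add: power2_eq_square algebra_simps)
    moreover have "0 \<le> 2 * Re (- of_real t * cnj B * B) + D"
      using assms(1)[of "- of_real t * cnj B"] True by simp
    ultimately show ?thesis by simp
  qed
  have "(cmod B)\<^sup>2 = 0"
  proof (rule ccontr)
    assume "(cmod B)\<^sup>2 \<noteq> 0"
    then show False using t[of "(D + 1) / (2 * (cmod B)\<^sup>2)"] by simp
  qed
  then show ?thesis using True by simp
next
  case False
  then have A: "0 < A" using assms(2) by simp
  have "Re (- (cnj B / of_real A) * B) = - (cmod B)\<^sup>2 / A"
    unfolding cmod_power2 by (simp add: power2_eq_square add_divide_distrib diff_divide_distrib)
  then have "0 \<le> A * (cmod B / A)\<^sup>2 - 2 * (cmod B)\<^sup>2 / A + D"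
    using assms(1)[of "- (cnj B / of_real A)"] A by (simp add: norm_divide)
  then show ?thesis using A by (simp add: power2_eq_square field_simps)
qed

lemma ex_unit_mult_eq_norm:
  fixes w :: complex
  shows "\<exists>c. cmod c = 1 \<and> c * w = of_real (cmod w)"
proof (cases "w = 0")
  case False
  then have "cnj w / of_real (cmod w) * w = of_real (cmod w)"
    using complex_norm_square[of w] by (simp add: field_simps power2_eq_square)
  with False show ?thesis
    by (intro exI[of _ "cnj w / of_real (cmod w)"]) (simp add: norm_divide)
qed (auto intro: exI[of _ 1])

section \<open>Approximate units in a subalgebra\<close>

locale cstar_subalg =
  fixes M :: "'a::cstar_algebra set"
  assumes M: "cstar_subalgebra M"
begin

lemma zero_mem: "0 \<in> M"
  and add_mem: "x \<in> M \<Longrightarrow> y \<in> M \<Longrightarrow> x + y \<in> M"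
  and scaleC_mem: "x \<in> M \<Longrightarrow> c *\<^sub>C x \<in> M"
  and mult_mem: "x \<in> M \<Longrightarrow> y \<in> M \<Longrightarrow> x * y \<in> M"
  and star_mem: "x \<in> M \<Longrightarrow> star x \<in> M"
  using M by (auto simp: cstar_subalgebra_def)

lemma scaleR_mem: "x \<in> M \<Longrightarrow> r *\<^sub>R x \<in> M"
  by (simp add: scaleR_scaleC scaleC_mem)

lemma minus_mem: "x \<in> M \<Longrightarrow> - x \<in> M"
  using scaleR_mem[of x "-1"] by simp

lemma diff_mem: "x \<in> M \<Longrightarrow> y \<in> M \<Longrightarrow> x - y \<in> M"
  using add_mem[of x "- y"] minus_mem by simp

lemmas mem = zero_mem add_mem scaleC_mem mult_mem star_mem scaleR_mem minus_mem diff_mem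

text \<open>The element \<open>e\<close> is \<open>f(m\<^sup>* m)\<close> with \<open>f(t) = n\<^sup>2 t\<^sup>2 / (1 + n\<^sup>2 t\<^sup>2)\<close>.\<close>

lemma ex_approx_unit:
  assumes m: "m \<in> M" and n: "0 < (n :: nat)"
  shows "\<exists>e\<in>M. norm e \<le> 1 \<and> (norm (m - m * e))\<^sup>2 \<le> 1 / n"
proof -
  define h where "h = star m * m"
  interpret h: self_adjoint h by unfold_locales (simp add: h_def star_simps)
  have hM: "h \<in> M" using m by (simp add: h_def mem)
  define g where "g t = n\<^sup>2 * t / (1 + n\<^sup>2 * t\<^sup>2)" for t :: real
  have pos: "0 < 1 + (real n)\<^sup>2 * t\<^sup>2" for t by (simp add: add_pos_nonneg)
  have g: "continuous_on UNIV g"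
    unfolding g_def by (intro continuous_intros) (metis of_nat_power pos less_irrefl)
  define e where "e = cfc h g h"
  have e_mult: "e * b = cfc h (\<lambda>t. g t * t) b" for b
    by (simp add: e_def h.cfc_times_right g h.cfc_mult_id)
  have gt: "g t * t = 1 - 1 / (1 + (real n)\<^sup>2 * t\<^sup>2)" for t
    using pos[of t] by (simp add: g_def field_simps power2_eq_square)
  have "norm (e * b) \<le> 1 * norm b" for b
    unfolding e_mult
  proof (rule h.norm_cfc_le[OF _ less_add_one])
    show "\<bar>g t * t\<bar> \<le> 1" for t
      using pos[of t] by (simp add: gt abs_le_iff)
  qed (intro continuous_intros g)
  then have "norm e \<le> 1" by (rule norm_le_if_mult_le) simp
  moreover have "(norm (m - m * e))\<^sup>2 \<le> 1 / n"
  proof -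
    \<comment> \<open>\<open>k\<close> stands for 1 - e, so
      \<open>star (m - m * e) * (m - m * e)\<close> is k(h) h k(h). The bound 1 / n comes from n |t|
      \<le> 1 + n^2 t^2, that is, |t k(t)| \<le> 1 / n.\<close>
    define k where "k t = 1 - g t * t" for t
    have k: "continuous_on UNIV k" unfolding k_def by (intro continuous_intros g)
    have star_e: "star e = e" unfolding e_def by (rule h.star_cfc_self[OF g])
    have k_act: "cfc h k b = b - e * b" for b
      unfolding k_def by (subst h.cfc_diff) (auto intro!: continuous_intros g simp: h.cfc_const e_mult)
    have "star (m - m * e) * (m - m * e) * b = cfc h (\<lambda>t. k t * (t * k t)) b" for b
    proof -
      have "star (m - m * e) * (m - m * e) * b = h * (b - e * b) - e * (h * (b - e * b))"
        by (simp add: star_simps star_e h_def algebra_simps)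
      also have "\<dots> = cfc h k (h * cfc h k b)" by (simp add: k_act)
      also have "\<dots> = cfc h (\<lambda>t. k t * (t * k t)) b"
        by (simp add: h.cfc_mult_id k h.cfc_mult continuous_on_mult)
      finally show ?thesis .
    qed
    moreover have "norm (cfc h (\<lambda>t. k t * (t * k t)) b) \<le> 1 / n * norm b" for b
    proof (rule h.norm_cfc_le[OF _ less_add_one])
      fix t :: real
      have k: "k t = 1 / (1 + (real n)\<^sup>2 * t\<^sup>2)" by (simp add: k_def gt)
      have "0 \<le> (real n * \<bar>t\<bar> - 1)\<^sup>2" "0 \<le> real n * \<bar>t\<bar>" by simp_all
      then have "real n * \<bar>t\<bar> \<le> 1 + (real n * \<bar>t\<bar>)\<^sup>2"
        unfolding power2_diff one_power2 mult_1_right by linarith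
      then have "real n * \<bar>t\<bar> \<le> 1 + (real n)\<^sup>2 * t\<^sup>2" by (simp add: power_mult_distrib)
      then have "\<bar>t * k t\<bar> \<le> 1 / n"
        using n pos[of t] by (simp add: k abs_mult field_simps)
      moreover have "\<bar>k t\<bar> \<le> 1" using pos[of t] by (simp add: k)
      ultimately show "\<bar>k t * (t * k t)\<bar> \<le> 1 / n"
        using mult_mono[of "\<bar>k t\<bar>" 1 "\<bar>t * k t\<bar>" "1 / n"] by (simp add: abs_mult)
    qed (intro continuous_intros k)
    ultimately have "norm (star (m - m * e) * (m - m * e) * b) \<le> 1 / n * norm b" for b
      by (simp only:)
    then have "norm (star (m - m * e) * (m - m * e)) \<le> 1 / n"
      by (rule norm_le_if_mult_le) simp
    then show ?thesis by (simp add: cstar_identity)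
  qed
  moreover have "e \<in> M" unfolding e_def by (rule h.cfc_mem[OF g M hM hM])
  ultimately show ?thesis by blast
qed

lemma ex_approx_unit_seq:
  assumes m: "m \<in> M"
  obtains e where "\<And>n. e n \<in> M" "\<And>n :: nat. norm (e n) \<le> 1" "(\<lambda>n. m * e n) \<longlonglongrightarrow> m"
proof -
  have "\<forall>n. \<exists>e\<in>M. norm e \<le> 1 \<and> (norm (m - m * e))\<^sup>2 \<le> inverse (real (Suc n))"
    using ex_approx_unit[OF m, of "Suc _"] by (simp add: inverse_eq_divide)
  then obtain e where e: "\<And>n. e n \<in> M" "\<And>n. norm (e n) \<le> 1"
    "\<And>n. (norm (m - m * e n))\<^sup>2 \<le> inverse (real (Suc n))" by metis
  have "(\<lambda>n. (norm (m - m * e n))\<^sup>2) \<longlonglongrightarrow> 0"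
    by (rule tendsto_sandwich[OF _ _ tendsto_const LIMSEQ_inverse_real_of_nat]) (use e in auto)
  then have "(\<lambda>n. norm (m - m * e n)) \<longlonglongrightarrow> 0"
    using tendsto_real_sqrt by fastforce
  then have "(\<lambda>n. m * e n) \<longlonglongrightarrow> m" by (rule tendsto_if_norm_diff_tendsto_0)
  with e(1,2) show thesis by (rule that)
qed

end

section \<open>Inequalities for a state of a subalgebra\<close>

locale cstar_state = cstar_subalg M for M :: "'a::cstar_algebra set" +
  fixes \<phi> :: "'a \<Rightarrow> complex"
  assumes state: "\<phi> \<in> states M"
begin

lemma add: "x \<in> M \<Longrightarrow> y \<in> M \<Longrightarrow> \<phi> (x + y) = \<phi> x + \<phi> y"
  and scale: "x \<in> M \<Longrightarrow> \<phi> (c *\<^sub>C x) = c * \<phi> x"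
  and square: "x \<in> M \<Longrightarrow> \<phi> (star x * x) \<in> \<real>\<^sub>\<ge>\<^sub>0"
  and bdd: "bdd_above ((\<lambda>x. cmod (\<phi> x)) ` {x \<in> M. norm x \<le> 1})"
  and sup: "(SUP x\<in>{x \<in> M. norm x \<le> 1}. cmod (\<phi> x)) = 1"
  and extensional: "\<phi> \<in> extensional M"
  using state by (auto simp: states_def)

lemma diff: "x \<in> M \<Longrightarrow> y \<in> M \<Longrightarrow> \<phi> (x - y) = \<phi> x - \<phi> y"
  using add[of x "(-1) *\<^sub>C y"] scale[of y "-1"] by (simp add: mem)

lemma square_Re: "x \<in> M \<Longrightarrow> 0 \<le> Re (\<phi> (star x * x))"
  and square_Im: "x \<in> M \<Longrightarrow> Im (\<phi> (star x * x)) = 0"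
  using square[of x] by (auto simp: complex_nonneg_Reals_iff)

lemma norm_le:
  assumes "x \<in> M"
  shows "cmod (\<phi> x) \<le> norm x"
proof (cases "x = 0")
  case True
  then show ?thesis using scale[of 0 0] zero_mem by simp
next
  case False
  let ?y = "of_real (1 / norm x) *\<^sub>C x"
  have "cmod (\<phi> ?y) \<le> (SUP x\<in>{x \<in> M. norm x \<le> 1}. cmod (\<phi> x))"
    using assms False by (intro cSUP_upper bdd) (auto simp: mem norm_scaleC norm_divide)
  then have "cmod (\<phi> ?y) \<le> 1" by (simp only: sup)
  then show ?thesis using False assms by (simp add: scale norm_divide norm_mult)
qed

lemma tendsto:
  assumes "\<And>n :: nat. X n \<in> M" "L \<in> M" "X \<longlonglongrightarrow> L"
  shows "(\<lambda>n. \<phi> (X n)) \<longlonglongrightarrow> \<phi> L"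
proof -
  have "(\<lambda>n. norm (L - X n)) \<longlonglongrightarrow> norm (L - L)" by (intro tendsto_intros assms)
  then have "(\<lambda>n. norm (L - X n)) \<longlonglongrightarrow> 0" by simp
  then have "(\<lambda>n. norm (\<phi> L - \<phi> (X n))) \<longlonglongrightarrow> 0"
    by (rule tendsto_sandwich[OF _ _ tendsto_const, rotated 2])
      (use norm_le[of "L - X _"] assms in \<open>auto simp: diff mem\<close>)
  then show ?thesis by (rule tendsto_if_norm_diff_tendsto_0)
qed

lemma expand:
  assumes "x \<in> M" "y \<in> M"
  shows "\<phi> (star (x + c *\<^sub>C y) * (x + c *\<^sub>C y)) = \<phi> (star x * x) + c * \<phi> (star x * y)
    + cnj c * \<phi> (star y * x) + of_real ((cmod c)\<^sup>2) * \<phi> (star y * y)"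
proof -
  have "star (x + c *\<^sub>C y) * (x + c *\<^sub>C y) = star x * x + c *\<^sub>C (star x * y)
      + cnj c *\<^sub>C (star y * x) + (c * cnj c) *\<^sub>C (star y * y)"
    by (simp add: star_simps algebra_simps mult_scaleC_left mult_scaleC_right scaleC_scaleC scaleC_add_right)
  then show ?thesis
    using assms by (simp add: add scale mem del: of_real_power flip: complex_norm_square)
qed

lemma hermitian_form:
  assumes "x \<in> M" "y \<in> M"
  shows "\<phi> (star y * x) = cnj (\<phi> (star x * y))"
proof -
  have "Im (\<phi> (star (x + c *\<^sub>C y) * (x + c *\<^sub>C y))) = 0" for c
    using assms by (intro square_Im mem)
  from this[of 1] this[of \<i>] show ?thesis
    using assms by (simp add: expand square_Im complex_eq_iff del: scaleC_one)
qed

lemma Cauchy_Schwarz: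
  assumes "x \<in> M" "y \<in> M"
  shows "(cmod (\<phi> (star x * y)))\<^sup>2 \<le> Re (\<phi> (star y * y)) * Re (\<phi> (star x * x))"
proof (rule discriminant_le)
  fix z
  have "0 \<le> Re (\<phi> (star (x + z *\<^sub>C y) * (x + z *\<^sub>C y)))"
    using assms by (intro square_Re mem)
  then show "0 \<le> Re (\<phi> (star y * y)) * (cmod z)\<^sup>2 + 2 * Re (z * \<phi> (star x * y)) + Re (\<phi> (star x * x))"
    using assms by (simp add: expand hermitian_form[of x y] mult.commute)
qed (use assms in \<open>simp add: square_Re\<close>)

lemma square_le: "x \<in> M \<Longrightarrow> Re (\<phi> (star x * x)) \<le> (norm x)\<^sup>2"
  using norm_le[of "star x * x"] complex_Re_le_cmod[of "\<phi> (star x * x)"]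
  by (simp add: mem cstar_identity)

text \<open>The form only knows products, so the identity is taken at m e_n for an approximate unit
  and passed to the limit.\<close>

lemma hermitian:
  assumes m: "m \<in> M"
  shows "\<phi> (star m) = cnj (\<phi> m)"
proof -
  obtain e where e: "\<And>n. e n \<in> M" "\<And>n. norm (e n) \<le> 1" "(\<lambda>n. m * e n) \<longlonglongrightarrow> m"
    by (rule ex_approx_unit_seq[OF m], rule that)
  have "\<phi> (star (m * e n)) = cnj (\<phi> (m * e n))" for n
    using hermitian_form[of "star m" "e n"] e m by (simp add: star_simps mem)
  moreover have "(\<lambda>n. \<phi> (star (m * e n))) \<longlonglongrightarrow> \<phi> (star m)"
    by (rule tendsto) (use e m in \<open>auto simp: mem intro: tendsto_star\<close>)
  moreover have "(\<lambda>n. cnj (\<phi> (m * e n))) \<longlonglongrightarrow> cnj (\<phi> m)"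
    by (intro tendsto_cnj tendsto) (use e m in \<open>auto simp: mem\<close>)
  ultimately show ?thesis using LIMSEQ_unique by simp
qed

text \<open>Cauchy-Schwarz with an approximate unit in place of 1. It acts on the right of
  \<open>star m\<close>, and hermitian symmetry brings back \<open>m\<close>.\<close>

lemma Kadison:
  assumes m: "m \<in> M"
  shows "(cmod (\<phi> m))\<^sup>2 \<le> Re (\<phi> (star m * m))"
proof -
  let ?m = "star m"
  have sm: "?m \<in> M" using m by (rule star_mem)
  obtain e where e: "\<And>n. e n \<in> M" "\<And>n. norm (e n) \<le> 1" "(\<lambda>n. ?m * e n) \<longlonglongrightarrow> ?m"
    by (rule ex_approx_unit_seq[OF sm], rule that)
  have "(cmod (\<phi> (?m * e n)))\<^sup>2 \<le> 1 * Re (\<phi> (?m * m))" for n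
  proof (rule order_trans[OF Cauchy_Schwarz[OF m e(1)] mult_right_mono])
    have "(norm (e n))\<^sup>2 \<le> 1" using e(2)[of n] by (simp add: power_le_one)
    then show "Re (\<phi> (star (e n) * e n)) \<le> 1" using square_le[OF e(1), of n] by simp
  qed (rule square_Re[OF m])
  moreover have "(\<lambda>n. (cmod (\<phi> (?m * e n)))\<^sup>2) \<longlonglongrightarrow> (cmod (\<phi> ?m))\<^sup>2"
    by (intro tendsto_intros tendsto) (use e sm in \<open>auto simp: mem\<close>)
  ultimately have "(cmod (\<phi> ?m))\<^sup>2 \<le> Re (\<phi> (?m * m))"
    by (intro LIMSEQ_le_const2) auto
  then show ?thesis by (simp add: hermitian[OF m])
qed

text \<open>
  The Cauchy-Schwarz inequality for the pair \<open>m\<^sup>*\<close>, \<open>1 - e\<close> and the extension of \<open>\<phi>\<close> to the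
  unitization with value 1 at 1; this extension is positive by the Kadison inequality.
\<close>

lemma norm_mult_diff_le:
  assumes m: "m \<in> M" and e: "e \<in> M" "norm e \<le> 1"
  shows "(cmod (\<phi> m - \<phi> (m * e)))\<^sup>2 \<le> (norm m)\<^sup>2 * (2 * (1 - Re (\<phi> e)))"
proof -
  let ?D = "1 - 2 * Re (\<phi> e) + Re (\<phi> (star e * e))"
  have A: "0 \<le> Re (\<phi> (m * star m))" "Re (\<phi> (m * star m)) \<le> (norm m)\<^sup>2"
    using square_Re[of "star m"] square_le[of "star m"] m by (auto simp: mem star_star)
  have "(norm e)\<^sup>2 \<le> 1" using e by (simp add: power_le_one)
  then have D: "?D \<le> 2 * (1 - Re (\<phi> e))" using square_le[OF e(1)] by simp
  have "(cmod (\<phi> m - \<phi> (m * e)))\<^sup>2 \<le> Re (\<phi> (m * star m)) * ?D"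
  proof (rule discriminant_le[OF _ A(1)])
    fix z
    \<comment> \<open>1 + \<open>?n\<close> is 1 - e + cnj z \<open>star m\<close> in the
      unitization; its square expands into the required quadratic expression in z.\<close>
    let ?n = "(-1) *\<^sub>C e + cnj z *\<^sub>C star m"
    have n: "?n \<in> M" using m e by (intro mem)
    have "0 \<le> (cmod (1 + \<phi> ?n))\<^sup>2" by simp
    also have "(cmod (1 + \<phi> ?n))\<^sup>2 = 1 + 2 * Re (\<phi> ?n) + (cmod (\<phi> ?n))\<^sup>2"
      unfolding cmod_power2 by (simp add: power2_eq_square algebra_simps)
    also have "\<dots> \<le> 1 + 2 * Re (\<phi> ?n) + Re (\<phi> (star ?n * ?n))"
      using Kadison[OF n] by simp
    also have "\<phi> ?n = - \<phi> e + cnj z * cnj (\<phi> m)"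
      using m e by (simp add: add scale hermitian mem del: scaleC.scale_minus_left)
    also have "\<phi> (star ?n * ?n) = \<phi> (star e * e) - cnj z * cnj (\<phi> (m * e)) - z * \<phi> (m * e)
        + of_real ((cmod z)\<^sup>2) * \<phi> (m * star m)"
    proof -
      have "\<phi> (star ?n * ?n) = \<phi> (star ((-1) *\<^sub>C e) * ((-1) *\<^sub>C e))
          + cnj z * \<phi> (star ((-1) *\<^sub>C e) * star m)
          + z * \<phi> (m * ((-1) *\<^sub>C e)) + of_real ((cmod z)\<^sup>2) * \<phi> (m * star m)"
        using m e by (subst expand) (auto simp: mem star_star)
      moreover have "\<phi> (star e * star m) = cnj (\<phi> (m * e))"
        using hermitian[of "m * e"] m e by (simp add: mem star_mult)
      moreover have "star ((-1) *\<^sub>C e) = (-1) *\<^sub>C star e" by (simp add: star_minus)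
      ultimately show ?thesis
        using m e by (simp only: mult_scaleC_left mult_scaleC_right scale mem) simp
    qed
    finally show "0 \<le> Re (\<phi> (m * star m)) * (cmod z)\<^sup>2 + 2 * Re (z * (\<phi> m - \<phi> (m * e))) + ?D"
      by (simp add: algebra_simps)
  qed
  also have "\<dots> \<le> (norm m)\<^sup>2 * (2 * (1 - Re (\<phi> e)))"
  proof (intro order_trans[OF mult_left_mono[OF D A(1)] mult_right_mono[OF A(2)]])
    show "0 \<le> 2 * (1 - Re (\<phi> e))"
      using norm_le[OF e(1)] e(2) complex_Re_le_cmod[of "\<phi> e"] by simp
  qed
  finally show ?thesis .
qed

text \<open>Elements of the unit ball where |\<phi>| is almost 1 are rotated to make \<phi> itself
  tend to 1; \<open>norm_mult_diff_le\<close> then makes one sequence serve all \<open>m\<close> at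
  once.\<close>

lemma ex_almost_unit_seq:
  obtains e where "\<And>n. e n \<in> M" "\<And>n :: nat. norm (e n) \<le> 1" "(\<lambda>n. \<phi> (e n)) \<longlonglongrightarrow> 1"
    "\<And>m. m \<in> M \<Longrightarrow> (\<lambda>n. \<phi> (m * e n)) \<longlonglongrightarrow> \<phi> m"
proof -
  have "\<exists>e\<in>M. norm e \<le> 1 \<and> cmod (1 - \<phi> e) \<le> inverse (real (Suc n))" for n
  proof -
    have "1 - inverse (real (Suc n)) < (SUP x\<in>{x \<in> M. norm x \<le> 1}. cmod (\<phi> x))"
      unfolding sup by simp
    then obtain x where x: "x \<in> M" "norm x \<le> 1" "1 - inverse (real (Suc n)) < cmod (\<phi> x)"
      using zero_mem by (subst (asm) less_cSUP_iff[OF _ bdd]) (auto intro: exI[of _ 0])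
    obtain c where c: "cmod c = 1" "c * \<phi> x = of_real (cmod (\<phi> x))"
      using ex_unit_mult_eq_norm by blast
    let ?e = "c *\<^sub>C x"
    have "\<phi> ?e = of_real (cmod (\<phi> x))" using x c by (simp add: scale)
    then have "1 - \<phi> ?e = of_real (1 - cmod (\<phi> x))" by simp
    moreover have "cmod (\<phi> x) \<le> 1" using norm_le[OF x(1)] x(2) by simp
    ultimately have "cmod (1 - \<phi> ?e) \<le> inverse (real (Suc n))"
      using x(3) by (simp only: norm_of_real)
    moreover have "norm ?e \<le> 1" using x(2) c by (simp add: norm_scaleC)
    ultimately show ?thesis using x(1) by (intro bexI[of _ ?e] conjI mem)
  qed
  then obtain e where e: "\<And>n. e n \<in> M" "\<And>n. norm (e n) \<le> 1"
    "\<And>n. cmod (1 - \<phi> (e n)) \<le> inverse (real (Suc n))" by metis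
  have "(\<lambda>n. cmod (1 - \<phi> (e n))) \<longlonglongrightarrow> 0"
    by (rule tendsto_sandwich[OF _ _ tendsto_const LIMSEQ_inverse_real_of_nat]) (use e in auto)
  then have lim: "(\<lambda>n. \<phi> (e n)) \<longlonglongrightarrow> 1" by (rule tendsto_if_norm_diff_tendsto_0)
  have "(\<lambda>n. \<phi> (m * e n)) \<longlonglongrightarrow> \<phi> m" if m: "m \<in> M" for m
  proof -
    have "(\<lambda>n. (norm m)\<^sup>2 * (2 * (1 - Re (\<phi> (e n))))) \<longlonglongrightarrow> (norm m)\<^sup>2 * (2 * (1 - Re 1))"
      by (intro tendsto_intros lim)
    then have "(\<lambda>n. (norm m)\<^sup>2 * (2 * (1 - Re (\<phi> (e n))))) \<longlonglongrightarrow> 0" by simp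
    then have "(\<lambda>n. (cmod (\<phi> m - \<phi> (m * e n)))\<^sup>2) \<longlonglongrightarrow> 0"
      by (rule tendsto_sandwich[OF _ _ tendsto_const, rotated 2])
        (use norm_mult_diff_le[OF m e(1) e(2)] in auto)
    then have "(\<lambda>n. cmod (\<phi> m - \<phi> (m * e n))) \<longlonglongrightarrow> 0"
      using tendsto_real_sqrt by fastforce
    then show ?thesis by (rule tendsto_if_norm_diff_tendsto_0)
  qed
  with e(1,2) lim show thesis by (rule that)
qed

text \<open>z + \<phi> m is the limit of \<phi> (z e_n + m e_n) along an almost unit sequence, so
  the extension to the unitization is controlled by how z + m acts on the unit ball of
  \<open>M\<close>.\<close>

lemma norm_add_le:
  assumes m: "m \<in> M" and le: "\<And>e. e \<in> M \<Longrightarrow> norm e \<le> 1 \<Longrightarrow> norm (z *\<^sub>C e + m * e) \<le> K"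
  shows "cmod (z + \<phi> m) \<le> K"
proof -
  obtain e where e: "\<And>n. e n \<in> M" "\<And>n :: nat. norm (e n) \<le> 1" "(\<lambda>n. \<phi> (e n)) \<longlonglongrightarrow> 1"
    and em: "\<And>m. m \<in> M \<Longrightarrow> (\<lambda>n. \<phi> (m * e n)) \<longlonglongrightarrow> \<phi> m"
    by (rule ex_almost_unit_seq, rule that)
  have "(\<lambda>n. cmod (z * \<phi> (e n) + \<phi> (m * e n))) \<longlonglongrightarrow> cmod (z * 1 + \<phi> m)"
    by (intro tendsto_intros e em m)
  moreover have "cmod (z * \<phi> (e n) + \<phi> (m * e n)) \<le> K" for n
    using norm_le[of "z *\<^sub>C e n + m * e n"] le[OF e(1) e(2), of n] e(1)[of n] m
    by (simp add: add scale mem)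
  ultimately show ?thesis by (intro LIMSEQ_le_const2) auto
qed

end

subsection \<open>Extending states along a homomorphism\<close>

text \<open>
  The unitization acts on the algebra by left multiplication. If the algebra is already
  unital, this operator norm is only a seminorm on the unitization.
\<close>

definition unit_norm :: "complex \<Rightarrow> 'a::cstar_algebra \<Rightarrow> real" where
  "unit_norm z y = onorm (\<lambda>b. z *\<^sub>C b + y * b)"

lemma bounded_linear_unit_op: "bounded_linear (\<lambda>b. z *\<^sub>C b + y * b :: 'a::cstar_algebra)"
  by (intro bounded_linear_add bounded_linear_scaleC bounded_linear_mult_right)

lemma norm_unit_op_le: "norm (z *\<^sub>C b + y * b) \<le> unit_norm z y * norm b"
  unfolding unit_norm_def by (rule onorm[OF bounded_linear_unit_op])

lemma unit_norm_le:
  assumes "0 \<le> C" "\<And>b. norm (z *\<^sub>C b + y * b) \<le> C * norm b"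
  shows "unit_norm z y \<le> C"
  unfolding unit_norm_def using assms by (rule onorm_bound)

lemma unit_norm_nonneg: "0 \<le> unit_norm z y"
  unfolding unit_norm_def by (rule onorm_pos_le[OF bounded_linear_unit_op])

lemma unit_norm_scaleC_le: "unit_norm (c * z) (c *\<^sub>C y) \<le> cmod c * unit_norm z y"
proof (rule unit_norm_le)
  fix b
  have "norm ((c * z) *\<^sub>C b + (c *\<^sub>C y) * b) = cmod c * norm (z *\<^sub>C b + y * b)"
    by (subst norm_scaleC[symmetric])
      (simp add: mult_scaleC_left scaleC_add_right scaleC_scaleC)
  also have "\<dots> \<le> cmod c * (unit_norm z y * norm b)"
    by (intro mult_left_mono norm_unit_op_le) simp
  finally show "norm ((c * z) *\<^sub>C b + (c *\<^sub>C y) * b) \<le> cmod c * unit_norm z y * norm b" by simp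
qed (simp add: unit_norm_nonneg)

lemma unit_norm_0_le: "unit_norm 0 y \<le> norm y"
  by (rule unit_norm_le) (simp_all add: norm_mult_ineq)

lemma unit_norm_square_le:
  fixes c :: "'a::cstar_algebra"
  assumes "norm (star c * c) < T"
  shows "unit_norm (- of_real T) (star c * c) \<le> T"
proof (rule unit_norm_le)
  show "0 \<le> T" using assms norm_ge_zero[of "star c * c"] by linarith
  show "norm (- of_real T *\<^sub>C b + star c * c * b) \<le> T * norm b" for b
    using norm_diff_star_mult_self_le[OF assms, of b]
    by (simp add: scaleC_of_real norm_minus_commute)
qed

text \<open>The cross terms in the square of i T + y cancel because y is self-adjoint. For large T
  of suitable sign, this growth rules out a nonzero imaginary part of the functional.\<close>

lemma unit_norm_imaginary_le:
  fixes y :: "'a::cstar_algebra"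
  assumes y: "star y = y"
  shows "(unit_norm (\<i> * of_real T) y)\<^sup>2 \<le> T\<^sup>2 + (norm y)\<^sup>2"
proof -
  have "norm ((\<i> * of_real T) *\<^sub>C b + y * b) \<le> sqrt (T\<^sup>2 + (norm y)\<^sup>2) * norm b" for b
  proof -
    let ?v = "(\<i> * of_real T) *\<^sub>C b + y * b"
    have "\<i> * (of_real T * (\<i> * of_real T)) = - (of_real T * of_real T :: complex)"
      by (simp add: algebra_simps)
    then have "star ?v * ?v = star b * (T\<^sup>2 *\<^sub>R b + y * (y * b))"
      by (simp add: star_simps y distrib_left distrib_right left_diff_distrib mult_scaleC_left
          mult_scaleC_right scaleC_scaleC mult.assoc power2_eq_square scaleR_scaleC scaleC_add_right
          scaleC.scale_right_diff_distrib)
    then have "(norm ?v)\<^sup>2 = norm (star b * (T\<^sup>2 *\<^sub>R b + y * (y * b)))"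
      by (simp flip: cstar_identity)
    also have "\<dots> \<le> norm b * norm (T\<^sup>2 *\<^sub>R b + y * (y * b))"
      using norm_mult_ineq[of "star b"] by simp
    also have "\<dots> \<le> norm b * (T\<^sup>2 * norm b + norm y * (norm y * norm b))"
    proof (intro mult_left_mono order_trans[OF norm_triangle_ineq] add_mono)
      show "norm (y * (y * b)) \<le> norm y * (norm y * norm b)"
        by (intro order_trans[OF norm_mult_ineq] mult_left_mono norm_mult_ineq norm_ge_zero)
    qed simp_all
    also have "\<dots> = (sqrt (T\<^sup>2 + (norm y)\<^sup>2) * norm b)\<^sup>2"
      by (simp add: power_mult_distrib power2_eq_square algebra_simps)
    finally show ?thesis by (rule power2_le_imp_le) simp
  qed
  then have "unit_norm (\<i> * of_real T) y \<le> sqrt (T\<^sup>2 + (norm y)\<^sup>2)"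
    by (rule unit_norm_le[rotated]) simp
  then have "(unit_norm (\<i> * of_real T) y)\<^sup>2 \<le> (sqrt (T\<^sup>2 + (norm y)\<^sup>2))\<^sup>2"
    by (rule power_mono) (rule unit_norm_nonneg)
  then show ?thesis by simp
qed

lemma (in cstar_homomorphism) sublinear_unit_norm: "sublinear (\<lambda>(z, a). unit_norm z (\<rho> a))"
  unfolding sublinear_def
proof (safe; clarsimp)
  fix z w a b
  show "unit_norm (z + w) (\<rho> (a + b)) \<le> unit_norm z (\<rho> a) + unit_norm w (\<rho> b)"
  proof (rule unit_norm_le)
    fix v
    have "norm ((z + w) *\<^sub>C v + \<rho> (a + b) * v)
        = norm ((z *\<^sub>C v + \<rho> a * v) + (w *\<^sub>C v + \<rho> b * v))"
      by (simp add: hom_add distrib_right scaleC_add_left algebra_simps)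
    also have "\<dots> \<le> unit_norm z (\<rho> a) * norm v + unit_norm w (\<rho> b) * norm v"
      by (intro order_trans[OF norm_triangle_ineq] add_mono norm_unit_op_le)
    finally show "norm ((z + w) *\<^sub>C v + \<rho> (a + b) * v)
        \<le> (unit_norm z (\<rho> a) + unit_norm w (\<rho> b)) * norm v" by (simp add: distrib_right)
  qed (simp add: unit_norm_nonneg)
next
  fix r :: real and z a
  assume r: "0 \<le> r"
  have "(r *\<^sub>R z) *\<^sub>C b = r *\<^sub>R (z *\<^sub>C b)" for b :: 'b
    by (metis scaleC_of_real scaleC_scaleC scaleR_conv_of_real)
  then have "unit_norm (r *\<^sub>R z) (\<rho> (r *\<^sub>R a)) = onorm (\<lambda>b. r *\<^sub>R (z *\<^sub>C b + \<rho> a * b))"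
    unfolding unit_norm_def by (simp add: hom_scaleR scaleR_add_right)
  then show "unit_norm (r *\<^sub>R z) (\<rho> (r *\<^sub>R a)) = r * unit_norm z (\<rho> a)"
    using r by (simp add: onorm_scaleR[OF bounded_linear_unit_op] unit_norm_def)
qed

text \<open>
  On the unitization of \<open>M\<close> the functional \<open>z + m \<mapsto> z + \<phi> m\<close> is bounded by the norm of
  \<open>z + \<rho> m\<close>, because \<open>\<rho>\<close> is isometric on \<open>M\<close>. A Hahn-Banach extension that respects this
  bound is automatically positive, since its value at 1 is 1.
\<close>

lemma ex_extends_state_ker:
  fixes \<rho> :: "'a::cstar_algebra \<Rightarrow> 'b::cstar_algebra"
  assumes "cstar_hom \<rho>" "cstar_subalgebra M" "inj_on \<rho> M" "\<phi> \<in> states M"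
  shows "\<exists>\<psi>. extends_state M \<phi> \<psi> \<and> (\<forall>a. \<rho> a = 0 \<longrightarrow> \<psi> a = 0)"
proof -
  interpret cstar_homomorphism \<rho> by unfold_locales fact
  interpret cstar_state M \<phi> by unfold_locales fact+
  let ?p = "\<lambda>(z, a). unit_norm z (\<rho> a)"
  let ?f = "\<lambda>(z, m). Re (z + \<phi> m)"
  have "\<exists>F. linear F \<and> (\<forall>v\<in>UNIV \<times> M. F v = ?f v) \<and> (\<forall>v. F v \<le> ?p v)"
  proof (rule Hahn_Banach[OF sublinear_unit_norm])
    show "subspace (UNIV \<times> M)"
      by (auto simp: subspace_def zero_prod_def mem)
    show "?f (v + w) = ?f v + ?f w" if "v \<in> UNIV \<times> M" "w \<in> UNIV \<times> M" for v w
      using that by (auto simp: add)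
    show "?f (r *\<^sub>R v) = r * ?f v" if "v \<in> UNIV \<times> M" for r v
    proof -
      have "\<phi> (r *\<^sub>R m) = of_real r * \<phi> m" if "m \<in> M" for m
        using scale[OF that, of "of_real r"] by (simp add: scaleC_of_real)
      then show ?thesis using that by (auto simp: algebra_simps)
    qed
    show "?f v \<le> ?p v" if "v \<in> UNIV \<times> M" for v
    proof -
      obtain z m where v: "v = (z, m)" and m: "m \<in> M" using \<open>v \<in> UNIV \<times> M\<close> by auto
      have "cmod (z + \<phi> m) \<le> unit_norm z (\<rho> m)"
      proof (rule norm_add_le[OF m])
        fix e assume e: "e \<in> M" "norm e \<le> 1"
        have "norm (z *\<^sub>C e + m * e) = norm (\<rho> (z *\<^sub>C e + m * e))"
          by (rule norm_hom_eq[symmetric, OF M assms(3)]) (use e m in \<open>simp add: mem\<close>)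
        also have "\<dots> = norm (z *\<^sub>C \<rho> e + \<rho> m * \<rho> e)" by (simp add: hom_add hom_scaleC hom_mult)
        also have "\<dots> \<le> unit_norm z (\<rho> m) * norm (\<rho> e)" by (rule norm_unit_op_le)
        also have "\<dots> \<le> unit_norm z (\<rho> m) * 1"
          using norm_hom_le[of e] e by (intro mult_left_mono unit_norm_nonneg) simp
        finally show "norm (z *\<^sub>C e + m * e) \<le> unit_norm z (\<rho> m)" by simp
      qed
      then show ?thesis using complex_Re_le_cmod[of "z + \<phi> m"] by (simp add: v)
    qed
  qed
  then obtain F where F: "linear F" "\<And>z m. m \<in> M \<Longrightarrow> F (z, m) = Re (z + \<phi> m)"
    "\<And>z a. F (z, a) \<le> unit_norm z (\<rho> a)" by auto
  have Fadd: "F (z + w, a + b) = F (z, a) + F (w, b)" for z w a b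
    using linear_add[OF F(1), of "(z, a)" "(w, b)"] by simp
  have Fscale: "F (of_real r * z, of_real r *\<^sub>C a) = r * F (z, a)" for r z a
    using linear_scale[OF F(1), of r "(z, a)"] by (simp add: scaleC_of_real scaleR_conv_of_real)
  \<comment> \<open>Hahn-Banach is real; a complex-linear functional is recovered from its real part
    F as F(a) - i F(i a).\<close>
  define \<psi> where "\<psi> a = Complex (F (0, a)) (- F (0, \<i> *\<^sub>C a))" for a
  have \<psi>_add: "\<psi> (a + b) = \<psi> a + \<psi> b" for a b
    using Fadd[of 0 0] by (simp add: \<psi>_def complex_eq_iff scaleC_add_right)
  have \<psi>_scale: "\<psi> (c *\<^sub>C a) = c * \<psi> a" for c a
  proof -
    have F_c: "F (0, c *\<^sub>C b) = Re c * F (0, b) + Im c * F (0, \<i> *\<^sub>C b)" for b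
    proof -
      have "c *\<^sub>C b = of_real (Re c) *\<^sub>C b + of_real (Im c) *\<^sub>C (\<i> *\<^sub>C b)"
        using complex_eq[of c] by (simp add: scaleC_scaleC mult.commute flip: scaleC_add_left)
      moreover have "F (0, u + v) = F (0, u) + F (0, v)" for u v using Fadd[of 0 0] by simp
      moreover have "F (0, of_real r *\<^sub>C u) = r * F (0, u)" for r u using Fscale[of r 0 u] by simp
      ultimately show ?thesis by (simp only:)
    qed
    have "F (0, \<i> *\<^sub>C (\<i> *\<^sub>C a)) = - F (0, a)"
      using Fscale[of "-1" 0 a] by (simp add: scaleC_scaleC)
    moreover have "\<i> *\<^sub>C (c *\<^sub>C a) = c *\<^sub>C (\<i> *\<^sub>C a)" by (simp add: scaleC_scaleC mult.commute)
    ultimately have "F (0, \<i> *\<^sub>C (c *\<^sub>C a)) = Re c * F (0, \<i> *\<^sub>C a) - Im c * F (0, a)"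
      by (simp only: F_c[of "\<i> *\<^sub>C a"])
    then show ?thesis
      by (simp add: \<psi>_def complex_eq_iff F_c[of a] del: scaleC.scale_scale)
  qed
  have F_eq: "F (z, a) = Re (z + \<psi> a)" for z a
    using Fadd[of z 0 0 a] F(2)[OF zero_mem, of z] scale[OF zero_mem, of 0] by (simp add: \<psi>_def)
  have bound: "cmod (z + \<psi> a) \<le> unit_norm z (\<rho> a)" for z a
  proof -
    let ?w = "z + \<psi> a"
    obtain c where c: "cmod c = 1" "c * ?w = of_real (cmod ?w)"
      using ex_unit_mult_eq_norm by blast
    from c(2) have "cmod ?w = Re (c * z + \<psi> (c *\<^sub>C a))"
      by (metis Re_complex_of_real \<psi>_scale distrib_left)
    also have "\<dots> \<le> unit_norm (c * z) (c *\<^sub>C \<rho> a)"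
      using F(3)[of "c * z" "c *\<^sub>C a"] by (simp add: F_eq hom_scaleC)
    also have "\<dots> \<le> unit_norm z (\<rho> a)"
      using unit_norm_scaleC_le[of c z "\<rho> a"] c by simp
    finally show ?thesis .
  qed
  have \<psi>_le: "cmod (\<psi> a) \<le> norm (\<rho> a)" for a
    using bound[of 0 a] unit_norm_0_le[of "\<rho> a"] by simp
  have \<psi>_norm: "cmod (\<psi> a) \<le> 1" if "norm a \<le> 1" for a
    using \<psi>_le[of a] norm_hom_le[of a] that by simp
  have ext: "\<psi> m = \<phi> m" if "m \<in> M" for m
    using F(2)[of _ 0] that by (simp add: \<psi>_def complex_eq_iff mem scale)
  have pos: "\<psi> (star c * c) \<in> \<real>\<^sub>\<ge>\<^sub>0" for c
  proof -
    let ?w = "\<psi> (star c * c)" and ?y = "star (\<rho> c) * \<rho> c"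
    have y: "\<rho> (star c * c) = ?y" "star ?y = ?y" by (simp_all add: hom_mult hom_star star_simps)
    define T where "T = norm ?y + 1"
    have T: "norm ?y < T" by (simp add: T_def)
    \<comment> \<open>The modulus of w - T is at most T, which keeps the real part of w from being
      negative.\<close>
    have "T - Re ?w \<le> cmod (- of_real T + ?w)"
      using complex_Re_le_cmod[of "- (- of_real T + ?w)"] by (simp only: norm_minus_cancel) simp
    also have "\<dots> \<le> unit_norm (- of_real T) ?y" using bound[of "- of_real T" "star c * c"] by (simp only: y)
    also have "\<dots> \<le> T" by (rule unit_norm_square_le[OF T])
    finally have "0 \<le> Re ?w" by simp
    moreover have "Im ?w = 0"
    proof (rule ccontr)
      assume Im: "Im ?w \<noteq> 0"
      \<comment> \<open>Chosen so that 2 S Im w is the square of \<open>norm ?y\<close> plus 1, one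
        more than the bound allows.\<close>
      define S where "S = ((norm ?y)\<^sup>2 + 1) / (2 * Im ?w)"
      have "(S + Im ?w)\<^sup>2 \<le> (cmod (\<i> * of_real S + ?w))\<^sup>2"
        by (simp add: cmod_power2)
      also have "\<dots> \<le> (unit_norm (\<i> * of_real S) ?y)\<^sup>2"
        using bound[of "\<i> * of_real S" "star c * c"] by (intro power_mono) (simp_all only: y norm_ge_zero)
      also have "\<dots> \<le> S\<^sup>2 + (norm ?y)\<^sup>2" by (rule unit_norm_imaginary_le[OF y(2)])
      finally have "2 * S * Im ?w + (Im ?w)\<^sup>2 \<le> (norm ?y)\<^sup>2" by (simp add: power2_sum)
      moreover have "2 * S * Im ?w = (norm ?y)\<^sup>2 + 1" using Im by (simp add: S_def)
      moreover have "0 \<le> (Im ?w)\<^sup>2" by simp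
      ultimately show False by linarith
    qed
    ultimately show ?thesis by (simp add: complex_nonneg_Reals_iff)
  qed
  have bdd\<psi>: "bdd_above ((\<lambda>x. cmod (\<psi> x)) ` {x. norm x \<le> 1})"
    using \<psi>_norm by (intro bdd_aboveI2[of _ _ 1]) simp
  have "(SUP x\<in>{x. norm x \<le> 1}. cmod (\<psi> x)) = 1"
  proof (rule antisym)
    show "(SUP x\<in>{x. norm x \<le> 1}. cmod (\<psi> x)) \<le> 1"
      using \<psi>_norm by (intro cSUP_least) (auto intro: exI[of _ 0])
    have "(SUP x\<in>{x \<in> M. norm x \<le> 1}. cmod (\<phi> x)) \<le> (SUP x\<in>{x. norm x \<le> 1}. cmod (\<psi> x))"
      using zero_mem by (intro cSUP_subset_mono bdd\<psi>) (auto simp: ext intro: exI[of _ 0])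
    then show "1 \<le> (SUP x\<in>{x. norm x \<le> 1}. cmod (\<psi> x))" by (simp only: sup)
  qed
  then have "\<psi> \<in> states UNIV"
    using \<psi>_add \<psi>_scale pos bdd\<psi> by (simp add: states_def)
  moreover have "restrict \<psi> M = \<phi>"
    using extensional by (auto simp: restrict_def extensional_def ext)
  moreover have "\<psi> a = 0" if "\<rho> a = 0" for a
    using \<psi>_le[of a] that by simp
  ultimately show ?thesis unfolding extends_state_def by blast
qed

subsection \<open>GNS representations vanishing on an ideal\<close>

text \<open>For any sequence X, a X_n stays in \<open>J\<close>, and \<psi> vanishes at
  \<open>star x * x\<close> for x in \<open>J\<close>, so the image sequence is null. Comparison
  with the operator of 0, rather than with a zero vector, is the form in which injectivity
  applies.\<close>

lemma gns_rep_eq_gns_rep_0: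
  fixes a :: "'a::cstar_algebra"
  assumes J: "\<And>x y. x \<in> J \<Longrightarrow> x * y \<in> J" "\<And>x y. y \<in> J \<Longrightarrow> x * y \<in> J" "\<And>x. x \<in> J \<Longrightarrow> star x \<in> J"
    and \<psi>: "\<psi> \<in> states UNIV" "\<And>x. x \<in> J \<Longrightarrow> \<psi> x = 0" and a: "a \<in> J"
  shows "gns_rep \<psi> a = gns_rep \<psi> 0"
proof -
  have add: "\<psi> (x + y) = \<psi> x + \<psi> y" for x y using \<psi>(1) by (simp add: states_def)
  have diff: "\<psi> (x - y) = \<psi> x - \<psi> y" for x y using add[of "x - y" y] by simp
  have semi: "form_seminorm (gns_form \<psi>) (x - y) = form_seminorm (gns_form \<psi>) (- y)"
    if "x \<in> J" for x y
  proof -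
    have "star (x - y) * (x - y) = star x * (x - y) - star y * x + star y * y"
      by (simp add: star_diff algebra_simps)
    then have "\<psi> (star (x - y) * (x - y)) = \<psi> (star (- y) * (- y))"
      using J(1)[OF J(3)[OF that]] J(2)[OF that] by (simp add: add diff \<psi>(2) star_minus)
    then show ?thesis by (simp add: form_seminorm_def gns_form_def)
  qed
  have zero: "form_seminorm (gns_form \<psi>) (x - y) = 0" if "x \<in> J" "y \<in> J" for x y
  proof -
    have "star (- y) * - y \<in> J" using J(2)[OF that(2), of "star y"] by (simp add: star_minus)
    then show ?thesis by (simp add: semi[OF that(1)]) (simp add: form_seminorm_def gns_form_def \<psi>(2))
  qed
  have cauchy: "X \<in> form_Cauchy (gns_form \<psi>)" if "\<And>n. X n \<in> J" for X
    using zero that by (auto simp: form_Cauchy_def)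
  have 0: "0 \<in> J" using J(1)[OF a, of 0] by simp
  have "form_rel (gns_form \<psi>) `` {\<lambda>n. a * X n} = form_rel (gns_form \<psi>) `` {\<lambda>n. 0 * X n}" for X
    using cauchy[of "\<lambda>n. a * X n"] cauchy[of "\<lambda>n. 0"] J(1)[OF a] 0
    by (auto simp: form_rel_def semi)
  then show ?thesis unfolding gns_rep_def by presburger
qed

theorem theorem3p2:
  fixes M :: "'a::cstar_algebra set"
    and S :: "('a \<Rightarrow> complex) set"
    and \<rho> :: "'a \<Rightarrow> 'b::cstar_algebra"
  assumes "cstar_subalgebra M"
    and "S \<subseteq> states M"
    and "\<forall>\<phi>\<in>S. \<exists>!\<psi>. extends_state M \<phi> \<psi>"
    and "faithful (direct_sum_rep S
           (\<lambda>\<phi>. gns_space (the_extension M \<phi>))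
           (\<lambda>\<phi>. gns_rep (the_extension M \<phi>)))"
    and "cstar_hom \<rho>"
  shows "inj \<rho> \<longleftrightarrow> inj_on \<rho> M"
proof
  assume "inj \<rho>"
  then show "inj_on \<rho> M" by (rule inj_on_subset) simp
next
  assume inj: "inj_on \<rho> M"
  interpret cstar_homomorphism \<rho> by unfold_locales fact
  let ?\<pi> = "direct_sum_rep S (\<lambda>\<phi>. gns_space (the_extension M \<phi>)) (\<lambda>\<phi>. gns_rep (the_extension M \<phi>))"
  have "a = 0" if a: "\<rho> a = 0" for a
  proof -
    have "gns_rep (the_extension M \<phi>) a = gns_rep (the_extension M \<phi>) 0" if \<phi>: "\<phi> \<in> S" for \<phi>
    proof -
      obtain \<psi> where \<psi>: "extends_state M \<phi> \<psi>" "\<And>a. \<rho> a = 0 \<Longrightarrow> \<psi> a = 0"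
        using ex_extends_state_ker[OF assms(5,1) inj] \<phi> assms(2) by blast
      have ext: "the_extension M \<phi> = \<psi>"
        unfolding the_extension_def using assms(3) \<phi> \<psi>(1) by (intro the1_equality) auto
      show ?thesis
        unfolding ext
        by (rule gns_rep_eq_gns_rep_0[where J = "{a. \<rho> a = 0}"])
          (use \<psi> a in \<open>auto simp: extends_state_def hom_mult hom_star\<close>)
    qed
    then have "?\<pi> a = ?\<pi> 0"
      unfolding direct_sum_rep_def by (intro restrict_ext) simp
    then show "a = 0" using assms(4) by (simp add: faithful_def inj_eq)
  qed
  then show "inj \<rho>"
    by (metis hom.diff injI right_minus_eq)
qed

end
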